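(* Let $M$ be a smooth manifold, $h\ge0$, $k\ge1$ integers, $c=(c_1,\dots,c_h)\in\mathbb{R}^h$ and $\tau(t)=\sum_{a=1}^hc_at^a$ a linear function on $\mathbb{R}^h$. Let $J\subseteq\mathbf{T}_h^{big}M$ be an untwisted stable Dirac-Jacobi structure of index $h$ on $M$ (with respect to $\tau$), and let $V_1,\dots,V_k$ be commuting vector fields on $M$ such that for every $p=1,\dots,k$ $$(X,u)\oplus(\alpha,v)\in\Gamma J\ \Longrightarrow\ \big([V_p,X]+d\tau(u)V_p,\ V_p(u)\big)\oplus\big(L_{V_p}\alpha,\ V_p(v)-\alpha(V_p)\,d\tau\big)\in\Gamma J,$$ where $d\tau(u)=c\cdot u$ and, in the last entry, $d\tau$ is regarded as the vector $c\in\mathbb{R}^h$. Then $$\hat J=\{(X-w\cdot V,\,u,\,\alpha(V))\oplus(\alpha,v,w)\ :\ (X,u)\oplus(\alpha,v)\in J,\ w\in\mathbb{R}^k\}$$ (where $w\cdot V=\sum_pw^pV_p$ and $\alpha(V)=(\alpha(V_1),\dots,\alpha(V_k))$) is an untwisted stable Dirac-Jacobi structure of index $h+k$ on $M$, with respect to the linear function $(t,s)\mapsto\tau(t)$ on $\mathbb{R}^h\times\mathbb{R}^k=\mathbb{R}^{h+k}$.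
   Context: All manifolds and maps are $C^\infty$. For an integer $h\ge0$, $\mathbf{T}_h^{big}M=(TM\times\mathbb{R}^h)\oplus(T^*M\times\mathbb{R}^h)$, with elements $(X,u)\oplus(\alpha,v)$ and neutral metric $$G((X_1,u_1)\oplus(\alpha_1,v_1),(X_2,u_2)\oplus(\alpha_2,v_2))=\tfrac12(\alpha_2(X_1)+\alpha_1(X_2)+u_1\cdot v_2+u_2\cdot v_1).$$ Sections have $X$ a vector field, $\alpha$ a $1$-form, and $u,v:M\to\mathbb{R}^h$ smooth. For a linear function $\tau=\sum_ac_at^a$ on $\mathbb{R}^h$, with $c=(c_a)$, the untwisted Wade (Courant-Jacobi) bracket of index $h$ is $$[(X_1,u_1)\oplus(\alpha_1,v_1),(X_2,u_2)\oplus(\alpha_2,v_2)]_W=([X_1,X_2],X_1u_2-X_2u_1)\oplus(\beta,y),$$ $$\beta=L_{X_1}\alpha_2-L_{X_2}\alpha_1+\tfrac12d(\alpha_1(X_2)-\alpha_2(X_1))+(c\cdot u_1)\alpha_2-(c\cdot u_2)\alpha_1+\tfrac12(u_2\cdot dv_1+v_2\cdot du_1-u_1\cdot dv_2-v_1\cdot du_2),$$ $$y=X_1v_2-X_2v_1+\tfrac12\big(\alpha_1(X_2)-\alpha_2(X_1)+u_2\cdot v_1-u_1\cdot v_2\big)c+(c\cdot u_1)v_2-(c\cdot u_2)v_1.$$ An untwisted stable Dirac-Jacobi structure of index $h$ (with respect to $\tau$) is a maximal $G$-isotropic subbundle $J\subseteq\mathbf{T}_h^{big}M$ (rank $\dim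 M+h$) whose space of sections is closed under this bracket. Elements of $\mathbf{T}^{big}_{h+k}M$ are written $(X,u,u')\oplus(\alpha,v,v')$ with $u,v\in\mathbb{R}^h$, $u',v'\in\mathbb{R}^k$. *)

theory Defs
  imports "HOL-Analysis.Analysis"
begin

section \<open>Smooth manifolds\<close>

text \<open>
  The model space is a finite-dimensional normed space \<open>'e\<close>. The class \<open>euclidean_space\<close> is not
  used because it excludes dimension 0.
\<close>

text \<open>On an open set, and with finite-dimensional domain, this is \<open>C\<^sup>k\<close>: all iterated directional
  derivatives up to order \<open>k\<close> exist and are continuous.\<close>

fun Ck_on :: "nat \<Rightarrow> 'e::real_normed_vector set \<Rightarrow> ('e \<Rightarrow> 'f::real_normed_vector) \<Rightarrow> bool" where
  "Ck_on 0 S f \<longleftrightarrow> continuous_on S f"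
| "Ck_on (Suc k) S f \<longleftrightarrow> (\<forall>x\<in>S. f differentiable (at x)) \<and>
     (\<forall>e. Ck_on k S (\<lambda>x. frechet_derivative f (at x) e))"

definition smooth_on :: "'e::real_normed_vector set \<Rightarrow> ('e \<Rightarrow> 'f::real_normed_vector) \<Rightarrow> bool" where
  "smooth_on S f \<longleftrightarrow> (\<forall>k. Ck_on k S f)"

text \<open>A chart is a pair of a domain and a coordinate map; the values of the map outside the domain
  are irrelevant.\<close>

type_synonym ('m, 'e) chart = "'m set \<times> ('m \<Rightarrow> 'e)"

definition chart_inv :: "('m, 'e) chart \<Rightarrow> 'e \<Rightarrow> 'm" where
  "chart_inv \<kappa> = inv_into (fst \<kappa>) (snd \<kappa>)"

definition is_chart ::
  "('m::topological_space, 'e::real_normed_vector) chart \<Rightarrow> bool" where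
  "is_chart \<kappa> \<longleftrightarrow> open (fst \<kappa>) \<and> open (snd \<kappa> ` fst \<kappa>) \<and>
     homeomorphism (fst \<kappa>) (snd \<kappa> ` fst \<kappa>) (snd \<kappa>) (chart_inv \<kappa>)"

definition transition :: "('m, 'e) chart \<Rightarrow> ('m, 'e) chart \<Rightarrow> 'e \<Rightarrow> 'e" where
  "transition \<kappa> \<kappa>' = snd \<kappa>' \<circ> chart_inv \<kappa>"

text \<open>A manifold is given by a (not necessarily maximal) smooth atlas; its underlying set is the union
  of the chart domains, with the subspace topology. In particular it may be empty.\<close>

definition smooth_manifold ::
  "('m::{t2_space, second_countable_topology}, 'e::real_normed_vector) chart set \<Rightarrow> bool" where
  "smooth_manifold A \<longleftrightarrow>
     (\<exists>B :: 'e set. finite B \<and> span B = UNIV) \<and>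
     (\<forall>\<kappa>\<in>A. is_chart \<kappa>) \<and>
     (\<forall>\<kappa>\<in>A. \<forall>\<kappa>'\<in>A. smooth_on (snd \<kappa> ` (fst \<kappa> \<inter> fst \<kappa>')) (transition \<kappa> \<kappa>'))"

definition points :: "('m, 'e) chart set \<Rightarrow> 'm set" where
  "points A = (\<Union>\<kappa>\<in>A. fst \<kappa>)"

definition charts_at :: "('m, 'e) chart set \<Rightarrow> 'm \<Rightarrow> ('m, 'e) chart set" where
  "charts_at A x = {\<kappa>\<in>A. x \<in> fst \<kappa>}"

definition smooth_fun ::
  "('m, 'e::real_normed_vector) chart set \<Rightarrow> 'm set \<Rightarrow> ('m \<Rightarrow> 'f::real_normed_vector) \<Rightarrow> bool" where
  "smooth_fun A W f \<longleftrightarrow> (\<forall>\<kappa>\<in>A. smooth_on (snd \<kappa> ` (fst \<kappa> \<inter> W)) (f \<circ> chart_inv \<kappa>))"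


section \<open>Tangent and cotangent vectors\<close>

text \<open>
  A tangent vector at \<open>x\<close> is the family of its components in the charts around \<open>x\<close>, related by the
  Jacobians of the transition maps; a cotangent vector is a family of linear functionals on the model
  space that transforms contragrediently. At charts not around \<open>x\<close> both are set to \<open>0\<close>, so that
  equality of such families is equality of vectors.
\<close>

type_synonym ('m, 'e) tvec = "('m, 'e) chart \<Rightarrow> 'e"
type_synonym ('m, 'e) covec = "('m, 'e) chart \<Rightarrow> 'e \<Rightarrow> real"

definition tangent_space ::
  "('m, 'e::real_normed_vector) chart set \<Rightarrow> 'm \<Rightarrow> ('m, 'e) tvec set" where
  "tangent_space A x = {X.
     (\<forall>\<kappa>\<in>charts_at A x. \<forall>\<kappa>'\<in>charts_at A x.
        X \<kappa>' = frechet_derivative (transition \<kappa> \<kappa>') (at (snd \<kappa> x)) (X \<kappa>)) \<and>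
     (\<forall>\<kappa>. \<kappa> \<notin> charts_at A x \<longrightarrow> X \<kappa> = 0)}"

definition cotangent_space ::
  "('m, 'e::real_normed_vector) chart set \<Rightarrow> 'm \<Rightarrow> ('m, 'e) covec set" where
  "cotangent_space A x = {\<alpha>.
     (\<forall>\<kappa>\<in>charts_at A x. linear (\<alpha> \<kappa>)) \<and>
     (\<forall>\<kappa>\<in>charts_at A x. \<forall>\<kappa>'\<in>charts_at A x. \<forall>e.
        \<alpha> \<kappa> e = \<alpha> \<kappa>' (frechet_derivative (transition \<kappa> \<kappa>') (at (snd \<kappa> x)) e)) \<and>
     (\<forall>\<kappa>. \<kappa> \<notin> charts_at A x \<longrightarrow> \<alpha> \<kappa> = (\<lambda>e. 0))}"

text \<open>The value of a covector on a vector does not depend on the chart chosen here.\<close>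

definition pairing :: "('m, 'e) chart set \<Rightarrow> 'm \<Rightarrow> ('m, 'e) covec \<Rightarrow> ('m, 'e) tvec \<Rightarrow> real" where
  "pairing A x \<alpha> X = (let \<kappa> = (SOME \<kappa>. \<kappa> \<in> charts_at A x) in \<alpha> \<kappa> (X \<kappa>))"

definition vector_field ::
  "('m, 'e::real_normed_vector) chart set \<Rightarrow> 'm set \<Rightarrow> ('m \<Rightarrow> ('m, 'e) tvec) \<Rightarrow> bool" where
  "vector_field A W X \<longleftrightarrow> (\<forall>x\<in>W. X x \<in> tangent_space A x) \<and>
     (\<forall>\<kappa>\<in>A. smooth_on (snd \<kappa> ` (fst \<kappa> \<inter> W)) (\<lambda>y. X (chart_inv \<kappa> y) \<kappa>))"

definition one_form ::
  "('m, 'e::real_normed_vector) chart set \<Rightarrow> 'm set \<Rightarrow> ('m \<Rightarrow> ('m, 'e) covec) \<Rightarrow> bool" where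
  "one_form A W \<alpha> \<longleftrightarrow> (\<forall>x\<in>W. \<alpha> x \<in> cotangent_space A x) \<and>
     (\<forall>\<kappa>\<in>A. \<forall>e. smooth_on (snd \<kappa> ` (fst \<kappa> \<inter> W)) (\<lambda>y. \<alpha> (chart_inv \<kappa> y) \<kappa> e))"

definition differential ::
  "('m, 'e::real_normed_vector) chart set \<Rightarrow> ('m \<Rightarrow> real) \<Rightarrow> 'm \<Rightarrow> ('m, 'e) covec" where
  "differential A f x \<kappa> = (if \<kappa> \<in> charts_at A x
     then frechet_derivative (f \<circ> chart_inv \<kappa>) (at (snd \<kappa> x)) else (\<lambda>e. 0))"

definition deriv_along :: "('m, 'e::real_normed_vector) chart set \<Rightarrow>
    ('m \<Rightarrow> ('m, 'e) tvec) \<Rightarrow> ('m \<Rightarrow> real) \<Rightarrow> 'm \<Rightarrow> real" where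
  "deriv_along A X f x = pairing A x (differential A f x) (X x)"

text \<open>In local coordinates
  \<open>[X, Y]\<^sup>i = X\<^sup>j \<partial>\<^sub>j Y\<^sup>i - Y\<^sup>j \<partial>\<^sub>j X\<^sup>i\<close> and
  \<open>(L\<^sub>X \<alpha>)\<^sub>i = X\<^sup>j \<partial>\<^sub>j \<alpha>\<^sub>i + \<alpha>\<^sub>j \<partial>\<^sub>i X\<^sup>j\<close>.\<close>

definition lie_bracket :: "('m, 'e::real_normed_vector) chart set \<Rightarrow>
    ('m \<Rightarrow> ('m, 'e) tvec) \<Rightarrow> ('m \<Rightarrow> ('m, 'e) tvec) \<Rightarrow> 'm \<Rightarrow> ('m, 'e) tvec" where
  "lie_bracket A X Y x \<kappa> = (if \<kappa> \<in> charts_at A x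
     then frechet_derivative (\<lambda>y. Y (chart_inv \<kappa> y) \<kappa>) (at (snd \<kappa> x)) (X x \<kappa>)
        - frechet_derivative (\<lambda>y. X (chart_inv \<kappa> y) \<kappa>) (at (snd \<kappa> x)) (Y x \<kappa>)
     else 0)"

definition lie_form :: "('m, 'e::real_normed_vector) chart set \<Rightarrow>
    ('m \<Rightarrow> ('m, 'e) tvec) \<Rightarrow> ('m \<Rightarrow> ('m, 'e) covec) \<Rightarrow> 'm \<Rightarrow> ('m, 'e) covec" where
  "lie_form A X \<alpha> x \<kappa> e = (if \<kappa> \<in> charts_at A x
     then frechet_derivative (\<lambda>y. \<alpha> (chart_inv \<kappa> y) \<kappa> e) (at (snd \<kappa> x)) (X x \<kappa>)
        + \<alpha> x \<kappa> (frechet_derivative (\<lambda>y. X (chart_inv \<kappa> y) \<kappa>) (at (snd \<kappa> x)) e)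
     else 0)"


section \<open>The big tangent bundle of index h\<close>

text \<open>\<open>\<real>\<^sup>h\<close> is rendered as the sequences vanishing from index \<open>h\<close> on, since \<open>h = 0\<close> is allowed and
  \<open>h\<close> and \<open>h + k\<close> occur together. Indices run from \<open>0\<close> to \<open>h - 1\<close>.\<close>

definition rvec :: "nat \<Rightarrow> (nat \<Rightarrow> real) set" where
  "rvec h = {u. \<forall>a\<ge>h. u a = 0}"

definition dot :: "nat \<Rightarrow> (nat \<Rightarrow> real) \<Rightarrow> (nat \<Rightarrow> real) \<Rightarrow> real" where
  "dot h u v = (\<Sum>a<h. u a * v a)"

text \<open>The identification \<open>\<real>\<^sup>h \<times> \<real>\<^sup>k = \<real>\<^sup>h\<^sup>+\<^sup>k\<close> and its first projection.\<close>

definition vec_append :: "nat \<Rightarrow> (nat \<Rightarrow> real) \<Rightarrow> (nat \<Rightarrow> real) \<Rightarrow> nat \<Rightarrow> real" where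
  "vec_append h u u' = (\<lambda>a. if a < h then u a else u' (a - h))"

definition vec_take :: "nat \<Rightarrow> (nat \<Rightarrow> real) \<Rightarrow> nat \<Rightarrow> real" where
  "vec_take h x = (\<lambda>a. if a < h then x a else 0)"

text \<open>\<open>Big X u \<alpha> v\<close> is \<open>(X, u) \<oplus> (\<alpha>, v)\<close>.\<close>

datatype ('m, 'e) big =
  Big (vecX: "('m, 'e) tvec") (vecu: "nat \<Rightarrow> real") (forma: "('m, 'e) covec") (vecv: "nat \<Rightarrow> real")

definition big_fibre ::
  "('m, 'e::real_normed_vector) chart set \<Rightarrow> nat \<Rightarrow> 'm \<Rightarrow> ('m, 'e) big set" where
  "big_fibre A h x = {Big X u \<alpha> v | X u \<alpha> v.
     X \<in> tangent_space A x \<and> u \<in> rvec h \<and> \<alpha> \<in> cotangent_space A x \<and> v \<in> rvec h}"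

definition metricG ::
  "('m, 'e) chart set \<Rightarrow> nat \<Rightarrow> 'm \<Rightarrow> ('m, 'e) big \<Rightarrow> ('m, 'e) big \<Rightarrow> real" where
  "metricG A h x s t =
     (pairing A x (forma t) (vecX s) + pairing A x (forma s) (vecX t)
      + dot h (vecu s) (vecv t) + dot h (vecu t) (vecv s)) / 2"

definition lin_comb ::
  "nat \<Rightarrow> (nat \<Rightarrow> real) \<Rightarrow> (nat \<Rightarrow> ('m, 'e::real_vector) big) \<Rightarrow> ('m, 'e) big" where
  "lin_comb r a s = Big (\<lambda>\<kappa>. \<Sum>j<r. a j *\<^sub>R vecX (s j) \<kappa>) (\<lambda>i. \<Sum>j<r. a j * vecu (s j) i)
     (\<lambda>\<kappa> e. \<Sum>j<r. a j * forma (s j) \<kappa> e) (\<lambda>i. \<Sum>j<r. a j * vecv (s j) i)"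

definition big_zero :: "('m, 'e::real_vector) big" where
  "big_zero = Big (\<lambda>\<kappa>. 0) (\<lambda>i. 0) (\<lambda>\<kappa> e. 0) (\<lambda>i. 0)"

definition big_section :: "('m, 'e::real_normed_vector) chart set \<Rightarrow> nat \<Rightarrow> 'm set \<Rightarrow>
    ('m \<Rightarrow> ('m, 'e) big) \<Rightarrow> bool" where
  "big_section A h W s \<longleftrightarrow>
     (\<forall>x\<in>W. s x \<in> big_fibre A h x) \<and>
     vector_field A W (\<lambda>x. vecX (s x)) \<and> (\<forall>a<h. smooth_fun A W (\<lambda>x. vecu (s x) a)) \<and>
     one_form A W (\<lambda>x. forma (s x)) \<and> (\<forall>a<h. smooth_fun A W (\<lambda>x. vecv (s x) a))"

definition subbundle :: "('m::topological_space, 'e::real_normed_vector) chart set \<Rightarrow> nat \<Rightarrow> nat \<Rightarrow>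
    ('m \<Rightarrow> ('m, 'e) big set) \<Rightarrow> bool" where
  "subbundle A h r J \<longleftrightarrow>
     (\<forall>x\<in>points A. \<exists>W s. open W \<and> x \<in> W \<and> W \<subseteq> points A \<and> (\<forall>j<r. big_section A h W (s j)) \<and>
        (\<forall>y\<in>W. J y = {lin_comb r a (\<lambda>j. s j y) | a. a \<in> rvec r} \<and>
               (\<forall>a. lin_comb r a (\<lambda>j. s j y) = big_zero \<longrightarrow> (\<forall>j<r. a j = 0))))"

definition sections :: "('m, 'e::real_normed_vector) chart set \<Rightarrow> nat \<Rightarrow>
    ('m \<Rightarrow> ('m, 'e) big set) \<Rightarrow> ('m \<Rightarrow> ('m, 'e) big) set" where
  "sections A h J = {s. big_section A h (points A) s \<and> (\<forall>x\<in>points A. s x \<in> J x)}"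

definition isotropic_subspace ::
  "('m, 'e::real_normed_vector) chart set \<Rightarrow> nat \<Rightarrow> 'm \<Rightarrow> ('m, 'e) big set \<Rightarrow> bool" where
  "isotropic_subspace A h x S \<longleftrightarrow>
     S \<subseteq> big_fibre A h x \<and> (\<forall>r a s. (\<forall>j<r. s j \<in> S) \<longrightarrow> lin_comb r a s \<in> S) \<and>
     (\<forall>s\<in>S. \<forall>t\<in>S. metricG A h x s t = 0)"

definition maximal_isotropic ::
  "('m, 'e::real_normed_vector) chart set \<Rightarrow> nat \<Rightarrow> 'm \<Rightarrow> ('m, 'e) big set \<Rightarrow> bool" where
  "maximal_isotropic A h x S \<longleftrightarrow> isotropic_subspace A h x S \<and>
     (\<forall>T. isotropic_subspace A h x T \<and> S \<subseteq> T \<longrightarrow> T = S)"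


section \<open>The Wade bracket and stable Dirac-Jacobi structures\<close>

text \<open>The linear function \<open>\<tau>\<close> enters through its coefficient vector \<open>c\<close>.\<close>

definition wade_bracket :: "('m, 'e::real_normed_vector) chart set \<Rightarrow> nat \<Rightarrow> (nat \<Rightarrow> real) \<Rightarrow>
    ('m \<Rightarrow> ('m, 'e) big) \<Rightarrow> ('m \<Rightarrow> ('m, 'e) big) \<Rightarrow> 'm \<Rightarrow> ('m, 'e) big" where
  "wade_bracket A h c s1 s2 x = (let
     X1 = (\<lambda>z. vecX (s1 z)); u1 = (\<lambda>z. vecu (s1 z)); \<alpha>1 = (\<lambda>z. forma (s1 z)); v1 = (\<lambda>z. vecv (s1 z));
     X2 = (\<lambda>z. vecX (s2 z)); u2 = (\<lambda>z. vecu (s2 z)); \<alpha>2 = (\<lambda>z. forma (s2 z)); v2 = (\<lambda>z. vecv (s2 z));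
     D = (\<lambda>f a. differential A (\<lambda>z. f z a) x);
     P = (\<lambda>z. pairing A z (\<alpha>1 z) (X2 z) - pairing A z (\<alpha>2 z) (X1 z))
   in Big
     (lie_bracket A X1 X2 x)
     (\<lambda>a. deriv_along A X1 (\<lambda>z. u2 z a) x - deriv_along A X2 (\<lambda>z. u1 z a) x)
     (\<lambda>\<kappa> e. lie_form A X1 \<alpha>2 x \<kappa> e - lie_form A X2 \<alpha>1 x \<kappa> e + (1/2) * differential A P x \<kappa> e
        + dot h c (u1 x) * \<alpha>2 x \<kappa> e - dot h c (u2 x) * \<alpha>1 x \<kappa> e
        + (1/2) * ((\<Sum>a<h. u2 x a * D v1 a \<kappa> e) + (\<Sum>a<h. v2 x a * D u1 a \<kappa> e)
                 - (\<Sum>a<h. u1 x a * D v2 a \<kappa> e) - (\<Sum>a<h. v1 x a * D u2 a \<kappa> e)))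
     (\<lambda>a. deriv_along A X1 (\<lambda>z. v2 z a) x - deriv_along A X2 (\<lambda>z. v1 z a) x
        + (1/2) * (P x + dot h (u2 x) (v1 x) - dot h (u1 x) (v2 x)) * c a
        + dot h c (u1 x) * v2 x a - dot h c (u2 x) * v1 x a))"

text \<open>The rank condition and fibrewise maximality are equivalent for isotropic subbundles, the metric being
  neutral; both are required. The coefficient vector \<open>c\<close> is determined by \<open>\<tau>\<close>.\<close>

definition stable_dirac_jacobi ::
  "('m::topological_space, 'e::real_normed_vector) chart set \<Rightarrow> nat \<Rightarrow> ((nat \<Rightarrow> real) \<Rightarrow> real) \<Rightarrow>
    ('m \<Rightarrow> ('m, 'e) big set) \<Rightarrow> bool" where
  "stable_dirac_jacobi A h \<tau> J \<longleftrightarrow>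
     subbundle A h (dim (UNIV :: 'e set) + h) J \<and>
     (\<forall>x\<in>points A. maximal_isotropic A h x (J x)) \<and>
     (\<exists>c\<in>rvec h. (\<forall>t\<in>rvec h. \<tau> t = dot h c t) \<and>
        (\<forall>s1\<in>sections A h J. \<forall>s2\<in>sections A h J. wade_bracket A h c s1 s2 \<in> sections A h J))"

end

theory Submission
  imports Defs
begin

text \<open>
  Write \<open>hat w s\<close> for the element of the enlarged structure determined by \<open>s \<in> J\<close> and \<open>w \<in> \<real>\<^sup>k\<close>, and
  \<open>\<Phi>\<^sub>p\<close> for the operation on \<open>\<Gamma>J\<close> given by \<open>V\<^sub>p\<close>. The map \<open>hat\<close> is linear and preserves the metrics, which
  settles the fibrewise part. The bracket of two sections is again of this form,
  \<open>[hat w\<^sub>1 s\<^sub>1, hat w\<^sub>2 s\<^sub>2] = hat \<omega> \<sigma>\<close> with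
  \<open>\<sigma> = [s\<^sub>1, s\<^sub>2] + \<Sum>\<^sub>p w\<^sub>2\<^sup>p \<Phi>\<^sub>p s\<^sub>1 - \<Sum>\<^sub>p w\<^sub>1\<^sup>p \<Phi>\<^sub>p s\<^sub>2\<close>, where \<open>\<omega>\<close> is the last block of the \<open>y\<close>-component
  of the left-hand side. This is a computation in coordinates that uses \<open>[V\<^sub>p, V\<^sub>q] = 0\<close>; the \<open>u'\<close>-component
  also needs the isotropy relations \<open>G(\<Phi>\<^sub>q s\<^sub>1, s\<^sub>2) = 0 = G(s\<^sub>1, \<Phi>\<^sub>q s\<^sub>2)\<close>.
\<close>

section \<open>Smooth maps on finite-dimensional normed spaces\<close>

text \<open>The hypothesis on \<open>V\<^sub>p\<close> expresses closure under brackets with the k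
  new sections. For a unit vector \<open>e\<^sub>p\<close>, the bracket of
  \<open>hat e\<^sub>p 0\<close> with \<open>hat 0 s\<close> is \<open>hat \<omega> \<sigma>\<close>
  with \<open>\<sigma> = - \<Phi>\<^sub>p s\<close> and
  \<open>\<omega> = - (c \<cdot> u) e\<^sub>p\<close>. The summand
  \<open>(c \<cdot> u) V\<^sub>p\<close> of \<open>\<Phi>\<^sub>p\<close> undoes the shift of the
  vector part by this \<omega>, and \<open>\<alpha>(V\<^sub>p) c\<close> comes from the multiple of
  c in the y-component. For coefficients w that are functions, their derivatives end up in \<omega>
  alone. Since \<open>hat\<close> is inverted by reading off components, a smooth section of the
  enlarged structure yields smooth s and w globally. Smoothness and tangency of the bracket are
  inherited from \<sigma> and \<omega>, so the identity is checked one chart at a time. The analytic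
  obstacle: the model space comes with neither a basis nor an inner product, and a form is smooth
  only in the sense that its values on fixed vectors are. The product rule for \<alpha>(X) is
  therefore obtained by expansion in a basis whose coordinate functionals are first shown to be
  bounded.\<close>

text \<open>Equivalence of norms in finite dimension: the norm of the vector with coordinates f has
  a positive minimum m on the compact set \<open>K\<close>, by independence of \<open>B\<close>, and
  scaling to coordinate sum 1 bounds each coordinate of x by \<open>norm x / m\<close>.\<close>

lemma bounded_linear_representation:
  fixes B :: "'e::real_normed_vector set"
  assumes "finite B" "independent B" "span B = UNIV"
  shows "bounded_linear (\<lambda>x. representation B x b)"
proof -
  define T where "T f = (\<Sum>b\<in>B. f b *\<^sub>R b)" for f :: "'e \<Rightarrow> real"
  \<comment> \<open>the coordinates of the vectors of \<open>l\<^sup>1\<close> norm 1, a compact set by Tychonoff\<close>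
  define K where "K = PiE UNIV (\<lambda>b::'e. {-1..1::real}) \<inter> (\<lambda>f. \<Sum>b\<in>B. \<bar>f b\<bar>) -` {1}"
  have coord: "continuous_on UNIV (\<lambda>f::'e \<Rightarrow> real. f b)" for b
    by simp
  have "compactin (product_topology (\<lambda>_. euclidean) UNIV) (PiE UNIV (\<lambda>b::'e. {-1..1::real}))"
    by (subst compactin_PiE) simp
  hence "compact (PiE UNIV (\<lambda>b::'e. {-1..1::real}))"
    by (simp add: euclidean_product_topology)
  moreover have "closed ((\<lambda>f::'e\<Rightarrow>real. \<Sum>b\<in>B. \<bar>f b\<bar>) -` {1})"
    using continuous_on_closed_vimage[OF closed_UNIV, of "\<lambda>f::'e\<Rightarrow>real. \<Sum>b\<in>B. \<bar>f b\<bar>"]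
      continuous_on_sum[of B UNIV "\<lambda>b f::'e\<Rightarrow>real. \<bar>f b\<bar>"] continuous_on_rabs[OF coord]
    by auto
  ultimately have K: "compact K" unfolding K_def by (rule compact_Int_closed)
  have contT: "continuous_on K (\<lambda>f. norm (T f))"
    unfolding T_def by (intro continuous_intros continuous_on_subset[OF coord]) auto
  have lin: "linear (\<lambda>x. representation B x b)" 
    using assms by (intro linearI) (auto simp: representation_add representation_scale)
  have repT: "T (representation B x) = x" for x
    unfolding T_def using assms by (subst sum_representation_eq) auto
  have "\<exists>m>0. \<forall>f\<in>K. m \<le> norm (T f)"
  proof (cases "K = {}")
    case True thus ?thesis by (auto intro: exI[of _ 1])
  next
    case False
    then obtain f where f: "f \<in> K" "\<And>g. g \<in> K \<Longrightarrow> norm (T f) \<le> norm (T g)"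
      using continuous_attains_inf[OF K _ contT] by blast
    have "T f \<noteq> 0"
    proof
      assume "T f = 0"
      hence "\<forall>b\<in>B. f b = 0" using assms unfolding T_def
        by (metis independent_explicit_finite_subsets order_refl)
      with f(1) show False by (simp add: K_def)
    qed
    with f(2) show ?thesis by (intro exI[of _ "norm (T f)"]) auto
  qed
  then obtain m where m: "m > 0" "\<And>f. f \<in> K \<Longrightarrow> m \<le> norm (T f)" by blast
  have bound: "\<bar>representation B x b\<bar> \<le> norm x * (1 / m)" for x
  proof -
    define s where "s = (\<Sum>b\<in>B. \<bar>representation B x b\<bar>)"
    have le: "\<bar>representation B x b\<bar> \<le> s" for b
    proof (cases "b \<in> B")
      case True
      show ?thesis unfolding s_def by (rule member_le_sum[OF True]) (use assms in auto)
    next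
      case False
      hence "representation B x b = 0" using representation_ne_zero[of B x b] by blast
      thus ?thesis by (simp add: s_def sum_nonneg)
    qed
    show ?thesis
    proof (cases "s = 0")
      case True with le[of b] m(1) show ?thesis by simp
    next
      case False
      hence s: "s > 0" using le[of b] by linarith
      have "(\<lambda>b. representation B x b / s) \<in> K"
        using s le by (auto simp: K_def abs_le_iff sum_divide_distrib[symmetric] s_def[symmetric]
          field_simps minus_le_iff abs_div_pos[symmetric])
      hence "m \<le> norm (T (\<lambda>b. representation B x b / s))" by (rule m(2))
      also have "T (\<lambda>b. representation B x b / s) = (1/s) *\<^sub>R T (representation B x)"
        by (simp add: T_def scaleR_sum_right)
      finally have "m * s \<le> norm x" using s by (simp add: repT field_simps)
      with le[of b] m(1) show ?thesis
        by (simp add: field_simps) (smt (verit) mult_left_mono)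
    qed
  qed
  show ?thesis using lin bound
    by (intro bounded_linear_intro[of _ "1/m"]) (auto simp: linear_add[OF lin] linear_scale[OF lin])
qed

text \<open>On an open set the derivative at a point only sees values in the set, so agreement
  passes to all orders. Coordinate expressions agree with the functions they represent only over a
  chart domain, which is why this is invoked at each such rewriting.\<close>

lemma Ck_on_cong:
  assumes "open S" "\<And>x. x \<in> S \<Longrightarrow> f x = g x" "Ck_on k S f"
  shows "Ck_on k S g"
  using assms(2,3)
proof (induction k arbitrary: f g)
  case 0 thus ?case using continuous_on_cong[of S S f g] by simp
next
  case (Suc k)
  have d: "(g has_derivative frechet_derivative f (at x)) (at x)" if "x \<in> S" for x
  proof (rule has_derivative_transform_within_open[of f _ x UNIV S])
    show "(f has_derivative frechet_derivative f (at x)) (at x)"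
      using Suc.prems(2) that by (simp add: frechet_derivative_works)
  qed (use assms that Suc.prems in auto)
  hence "frechet_derivative f (at x) e = frechet_derivative g (at x) e" if "x \<in> S" for x e
    using that frechet_derivative_at by metis
  hence "Ck_on k S (\<lambda>x. frechet_derivative g (at x) e)" for e
    by (rule Suc.IH) (use Suc.prems(2) in auto)
  thus ?case using d by (auto simp: differentiable_def)
qed

lemma Ck_on_SucD: "Ck_on (Suc k) S f \<Longrightarrow> Ck_on k S f"
proof (induction k arbitrary: f)
  case 0 thus ?case
    by (auto intro!: continuous_at_imp_continuous_on differentiable_imp_continuous_within)
next
  case (Suc k) 
  from Suc.prems show ?case using Suc.IH by (metis Ck_on.simps(2))
qed

lemma Ck_on_mono: "Ck_on k S f \<Longrightarrow> T \<subseteq> S \<Longrightarrow> Ck_on k T f"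
  by (induction k arbitrary: f) (auto intro: continuous_on_subset)

lemma Ck_on_const: "Ck_on k S (\<lambda>x. c)"
  by (induction k arbitrary: c) auto

text \<open>The definition fixes the derivative to be \<open>frechet_derivative\<close>; here any
  explicit derivative \<open>f'\<close> is accepted, so the usual derivative rules can drive the
  inductions on the order.\<close>

lemma Ck_on_SucI:
  assumes "open S" "\<And>x. x \<in> S \<Longrightarrow> (f has_derivative f' x) (at x)"
    "\<And>e. Ck_on k S (\<lambda>x. f' x e)"
  shows "Ck_on (Suc k) S f"
proof -
  have "Ck_on k S (\<lambda>x. frechet_derivative f (at x) e)" for e
    by (rule Ck_on_cong[OF assms(1) _ assms(3)[of e]]) (metis assms(2) frechet_derivative_at)
  thus ?thesis using assms(2) by (auto simp: differentiable_def)
qed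

lemma Ck_on_SucD_deriv:
  assumes "Ck_on (Suc k) S f" "x \<in> S"
  shows "(f has_derivative frechet_derivative f (at x)) (at x)"
  using assms by (simp add: frechet_derivative_works)

lemma Ck_on_add:
  assumes "open S" "Ck_on k S f" "Ck_on k S g"
  shows "Ck_on k S (\<lambda>x. f x + g x)"
  using assms(2,3)
proof (induction k arbitrary: f g)
  case 0 thus ?case by (auto intro: continuous_intros)
next
  case (Suc k)
  show ?case
    by (rule Ck_on_SucI[OF assms(1) has_derivative_add[OF Ck_on_SucD_deriv Ck_on_SucD_deriv]])
       (use Suc in auto)
qed

lemma Ck_on_bounded_linear:
  assumes "open S" "bounded_linear T" "Ck_on k S f"
  shows "Ck_on k S (\<lambda>x. T (f x))"
  using assms(3)
proof (induction k arbitrary: f)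
  case 0 thus ?case using bounded_linear.continuous_on[OF assms(2)] by auto
next
  case (Suc k)
  show ?case
    by (rule Ck_on_SucI[OF assms(1) bounded_linear.has_derivative[OF assms(2) Ck_on_SucD_deriv]])
       (use Suc in auto)
qed

text \<open>Each of the two terms of the product rule pairs one derivative with one undifferentiated
  factor. The latter is taken with one order less by \<open>Ck_on_SucD\<close>, so the induction
  hypothesis applies to both terms.\<close>

lemma Ck_on_bilinear:
  assumes "open S" "bounded_bilinear P" "Ck_on k S f" "Ck_on k S g"
  shows "Ck_on k S (\<lambda>x. P (f x) (g x))"
  using assms(3,4)
proof (induction k arbitrary: f g)
  case 0 thus ?case using bounded_bilinear.continuous_on[OF assms(2)] by auto
next
  case (Suc k)
  show ?case
    by (rule Ck_on_SucI[OF assms(1)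
          bounded_bilinear.FDERIV[OF assms(2) Ck_on_SucD_deriv Ck_on_SucD_deriv]])
       (use Suc.prems Ck_on_SucD[OF Suc.prems(1)] Ck_on_SucD[OF Suc.prems(2)] in
         \<open>auto intro!: Ck_on_add[OF assms(1)] Suc.IH\<close>)
qed

lemma smooth_on_cong:
  "open S \<Longrightarrow> (\<And>x. x \<in> S \<Longrightarrow> f x = g x) \<Longrightarrow> smooth_on S f \<Longrightarrow> smooth_on S g"
  unfolding smooth_on_def using Ck_on_cong by blast

lemma smooth_on_mono: "smooth_on S f \<Longrightarrow> T \<subseteq> S \<Longrightarrow> smooth_on T f"
  unfolding smooth_on_def using Ck_on_mono by blast

lemma smooth_on_const: "smooth_on S (\<lambda>x. c)"
  by (simp add: smooth_on_def Ck_on_const)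

lemma smooth_on_add:
  "open S \<Longrightarrow> smooth_on S f \<Longrightarrow> smooth_on S g \<Longrightarrow> smooth_on S (\<lambda>x. f x + g x)"
  by (simp add: smooth_on_def Ck_on_add)

lemma smooth_on_bounded_linear:
  "open S \<Longrightarrow> bounded_linear T \<Longrightarrow> smooth_on S f \<Longrightarrow> smooth_on S (\<lambda>x. T (f x))"
  by (simp add: smooth_on_def Ck_on_bounded_linear)

lemma smooth_on_scaleR:
  "open S \<Longrightarrow> smooth_on S f \<Longrightarrow> smooth_on S g \<Longrightarrow> smooth_on S (\<lambda>x. f x *\<^sub>R g x)"
  by (simp add: smooth_on_def Ck_on_bilinear bounded_bilinear_scaleR)

lemma smooth_on_mult:
  fixes f :: "'e::real_normed_vector \<Rightarrow> real"
  shows "open S \<Longrightarrow> smooth_on S f \<Longrightarrow> smooth_on S g \<Longrightarrow> smooth_on S (\<lambda>x. f x * g x)"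
  by (simp add: smooth_on_def Ck_on_bilinear bounded_bilinear_mult)

lemma smooth_on_diff:
  assumes "open S" "smooth_on S f" "smooth_on S g" shows "smooth_on S (\<lambda>x. f x - g x)"
  using smooth_on_add[OF assms(1,2) 
      smooth_on_bounded_linear[OF assms(1) bounded_linear_minus[OF bounded_linear_ident] assms(3)]]
  by simp

lemma smooth_on_sum:
  assumes "open S" "\<And>i. i \<in> I \<Longrightarrow> smooth_on S (f i)"
  shows "smooth_on S (\<lambda>x. \<Sum>i\<in>I. f i x)"
  using assms(2)
  by (induction I rule: infinite_finite_induct)
     (auto simp: smooth_on_const intro!: smooth_on_add[OF assms(1)])

lemma smooth_on_has_derivative:
  assumes "smooth_on S f" "x \<in> S"
  shows "(f has_derivative frechet_derivative f (at x)) (at x)"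
  using assms Ck_on_SucD_deriv[of 0] unfolding smooth_on_def by blast

lemma smooth_on_deriv:
  assumes "smooth_on S f" shows "smooth_on S (\<lambda>x. frechet_derivative f (at x) e)"
  using assms unfolding smooth_on_def by (metis Ck_on.simps(2))

lemma finite_basis_exists:
  assumes "\<exists>B :: 'e::real_normed_vector set. finite B \<and> span B = UNIV"
  obtains B :: "'e::real_normed_vector set" where "finite B" "independent B" "span B = UNIV"
proof -
  obtain B0 :: "'e set" where B0: "finite B0" "span B0 = UNIV" using assms by blast
  obtain B where "B \<subseteq> B0" "independent B" "B0 \<subseteq> span B"
    using maximal_independent_subset[of B0] by auto
  with B0 show thesis
    by (metis finite_subset span_mono span_span subset_UNIV subset_antisym that)
qed

lemma linear_expand:
  assumes "linear F" "finite B" "independent B" "span B = UNIV"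
  shows "F v = (\<Sum>b\<in>B. representation B v b *\<^sub>R F b)"
proof -
  have "F (\<Sum>b\<in>B. representation B v b *\<^sub>R b) = (\<Sum>b\<in>B. representation B v b *\<^sub>R F b)"
    by (simp add: assms(1) linear_sum linear_scale)
  thus ?thesis using assms by (subst (asm) sum_representation_eq) auto
qed

text \<open>\<open>F\<close> is smooth only on each fixed vector. Expanding \<open>X y\<close> in a
  basis leaves a finite sum of products of the smooth coordinates of \<open>X\<close> with the
  smooth maps \<open>F y b\<close>.\<close>

lemma smooth_on_apply:
  fixes F :: "'a::real_normed_vector \<Rightarrow> 'e::real_normed_vector \<Rightarrow> 'f::real_normed_vector"
  assumes fd: "\<exists>B :: 'e set. finite B \<and> span B = UNIV" and S: "open S"
    and F: "\<And>e. smooth_on S (\<lambda>y. F y e)" "\<And>y. y \<in> S \<Longrightarrow> linear (F y)" and X: "smooth_on S X"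
  shows "smooth_on S (\<lambda>y. F y (X y))"
proof -
  obtain B :: "'e set" where B: "finite B" "independent B" "span B = UNIV"
    using finite_basis_exists[OF fd] .
  have "smooth_on S (\<lambda>y. \<Sum>b\<in>B. representation B (X y) b *\<^sub>R F y b)"
    by (intro smooth_on_sum S smooth_on_scaleR F 
        smooth_on_bounded_linear[OF S bounded_linear_representation[OF B]] X)
  thus ?thesis
    by (rule smooth_on_cong[OF S, rotated]) (simp add: linear_expand[OF F(2) B, symmetric])
qed

text \<open>Product rule for evaluation: the first term differentiates \<open>F\<close> on the
  vector frozen at \<open>X x\<close>. The basis disappears from the result because the sums over it
  are collected again by linearity.\<close>

lemma has_derivative_apply:
  fixes F :: "'a::real_normed_vector \<Rightarrow> 'e::real_normed_vector \<Rightarrow> 'f::real_normed_vector"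
  assumes fd: "\<exists>B :: 'e set. finite B \<and> span B = UNIV" and S: "open S" "x \<in> S"
    and F: "\<And>e. smooth_on S (\<lambda>y. F y e)" "\<And>y. y \<in> S \<Longrightarrow> linear (F y)" and X: "smooth_on S X"
  shows "((\<lambda>y. F y (X y)) has_derivative
    (\<lambda>e. frechet_derivative (\<lambda>y. F y (X x)) (at x) e + F x (frechet_derivative X (at x) e))) (at x)"
proof -
  obtain B :: "'e set" where B: "finite B" "independent B" "span B = UNIV"
    using finite_basis_exists[OF fd] .
  note bl = bounded_linear_representation[OF B]
  have eq: "F y v = (\<Sum>b\<in>B. representation B v b *\<^sub>R F y b)" if "y \<in> S" for y v
    using linear_expand[OF F(2)[OF that] B] .
  have d: "((\<lambda>y. F y b) has_derivative frechet_derivative (\<lambda>y. F y b) (at x)) (at x)" for b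
    using smooth_on_has_derivative[OF F(1) S(2)] .
  have dX: "(X has_derivative frechet_derivative X (at x)) (at x)"
    using smooth_on_has_derivative[OF X S(2)] .
  have "((\<lambda>y. F y (X x)) has_derivative 
      (\<lambda>e. \<Sum>b\<in>B. representation B (X x) b *\<^sub>R frechet_derivative (\<lambda>y. F y b) (at x) e)) (at x)"
    by (rule has_derivative_transform_within_open[OF _ S, 
          of "\<lambda>y. \<Sum>b\<in>B. representation B (X x) b *\<^sub>R F y b"])
       (auto intro!: derivative_eq_intros d simp: eq[symmetric])
  hence 1: "frechet_derivative (\<lambda>y. F y (X x)) (at x) e =
      (\<Sum>b\<in>B. representation B (X x) b *\<^sub>R frechet_derivative (\<lambda>y. F y b) (at x) e)" for e
    using frechet_derivative_at by metis
  have "((\<lambda>y. F y (X y)) has_derivative 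
      (\<lambda>e. \<Sum>b\<in>B. representation B (X x) b *\<^sub>R frechet_derivative (\<lambda>y. F y b) (at x) e
         + representation B (frechet_derivative X (at x) e) b *\<^sub>R F x b)) (at x)"
    by (rule has_derivative_transform_within_open[OF _ S, 
          of "\<lambda>y. \<Sum>b\<in>B. representation B (X y) b *\<^sub>R F y b"])
       (auto intro!: has_derivative_sum has_derivative_scaleR d bounded_linear.has_derivative[OF bl] dX
         simp: eq[symmetric])
  thus ?thesis by (simp add: 1 eq[OF S(2), of "frechet_derivative X (at x) _"] sum.distrib)
qed

section \<open>Coordinate derivatives on a manifold\<close>

definition smooth_in :: "('m, 'e::real_normed_vector) chart \<Rightarrow> 'm set \<Rightarrow> ('m \<Rightarrow> 'f::real_normed_vector) \<Rightarrow> bool"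
  where "smooth_in \<kappa> W f \<longleftrightarrow> smooth_on (snd \<kappa> ` (fst \<kappa> \<inter> W)) (\<lambda>y. f (chart_inv \<kappa> y))"

text \<open>One operator for functions, for components \<open>X z \<kappa>\<close> of vector fields
  and for values \<open>\<alpha> z \<kappa> e\<close> of forms. With the chart fixed,
  \<open>lie_bracket\<close>, \<open>lie_form\<close> and \<open>differential\<close> all reduce to
  it, and the bracket identity becomes algebra with linear maps.\<close>

definition loc_deriv :: "('m, 'e::real_normed_vector) chart \<Rightarrow> 'm \<Rightarrow> ('m \<Rightarrow> 'f::real_normed_vector) \<Rightarrow> 'e \<Rightarrow> 'f"
  where "loc_deriv \<kappa> x f = frechet_derivative (\<lambda>y. f (chart_inv \<kappa> y)) (at (snd \<kappa> x))"

lemma smooth_fun_iff: "smooth_fun A W f \<longleftrightarrow> (\<forall>\<kappa>\<in>A. smooth_in \<kappa> W f)"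
  by (simp add: smooth_fun_def smooth_in_def o_def)

lemma vector_field_iff: "vector_field A W X \<longleftrightarrow>
    (\<forall>x\<in>W. X x \<in> tangent_space A x) \<and> (\<forall>\<kappa>\<in>A. smooth_in \<kappa> W (\<lambda>x. X x \<kappa>))"
  by (simp add: vector_field_def smooth_in_def)

lemma one_form_iff: "one_form A W \<alpha> \<longleftrightarrow>
    (\<forall>x\<in>W. \<alpha> x \<in> cotangent_space A x) \<and> (\<forall>\<kappa>\<in>A. \<forall>e. smooth_in \<kappa> W (\<lambda>x. \<alpha> x \<kappa> e))"
  by (simp add: one_form_def smooth_in_def)

lemma charts_at_iff: "\<kappa> \<in> charts_at A x \<longleftrightarrow> \<kappa> \<in> A \<and> x \<in> fst \<kappa>"
  by (simp add: charts_at_def)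

lemma lie_bracket_eq:
  "\<kappa> \<in> charts_at A x \<Longrightarrow> lie_bracket A X Y x \<kappa> =
     loc_deriv \<kappa> x (\<lambda>z. Y z \<kappa>) (X x \<kappa>) - loc_deriv \<kappa> x (\<lambda>z. X z \<kappa>) (Y x \<kappa>)"
  by (simp add: lie_bracket_def loc_deriv_def)

lemma lie_form_eq:
  "\<kappa> \<in> charts_at A x \<Longrightarrow> lie_form A X \<alpha> x \<kappa> e =
     loc_deriv \<kappa> x (\<lambda>z. \<alpha> z \<kappa> e) (X x \<kappa>) + \<alpha> x \<kappa> (loc_deriv \<kappa> x (\<lambda>z. X z \<kappa>) e)"
  by (simp add: lie_form_def loc_deriv_def)

lemma differential_eq:
  "\<kappa> \<in> charts_at A x \<Longrightarrow> differential A f x \<kappa> e = loc_deriv \<kappa> x f e"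
  by (simp add: differential_def loc_deriv_def o_def)

text \<open>Vectors and covectors are families over all charts, so an equality between them must
  also be checked at charts that miss x, where both sides are 0.\<close>

lemma off_charts:
  assumes "\<kappa> \<notin> charts_at A x"
  shows "lie_bracket A X Y x \<kappa> = 0" "lie_form A X \<alpha> x \<kappa> e = 0" "differential A f x \<kappa> e = 0"
  using assms by (auto simp: lie_bracket_def lie_form_def differential_def)

lemma off_charts_space:
  assumes "\<kappa> \<notin> charts_at A x"
  shows "X \<in> tangent_space A x \<Longrightarrow> X \<kappa> = 0" "\<alpha> \<in> cotangent_space A x \<Longrightarrow> \<alpha> \<kappa> e = 0"
  using assms unfolding tangent_space_def cotangent_space_def by (blast, metis (mono_tags, lifting) mem_Collect_eq)

lemma linear_loc_form:
  "\<alpha> \<in> cotangent_space A x \<Longrightarrow> \<kappa> \<in> charts_at A x \<Longrightarrow> linear (\<alpha> \<kappa>)"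
  by (simp add: cotangent_space_def)

text \<open>The Jacobian that carries \<open>X \<kappa>\<close> to the chosen chart is the one
  through which \<open>\<alpha> \<kappa>\<close> factors, so it cancels.\<close>

lemma pairing_eq:
  assumes "\<alpha> \<in> cotangent_space A x" "X \<in> tangent_space A x" "\<kappa> \<in> charts_at A x"
  shows "pairing A x \<alpha> X = \<alpha> \<kappa> (X \<kappa>)"
proof -
  define \<kappa>0 where "\<kappa>0 = (SOME \<kappa>. \<kappa> \<in> charts_at A x)"
  have "\<kappa>0 \<in> charts_at A x" unfolding \<kappa>0_def using assms(3) by (rule someI)
  hence "\<alpha> \<kappa> (X \<kappa>) = \<alpha> \<kappa>0 (frechet_derivative (transition \<kappa> \<kappa>0) (at (snd \<kappa> x)) (X \<kappa>))"
      "X \<kappa>0 = frechet_derivative (transition \<kappa> \<kappa>0) (at (snd \<kappa> x)) (X \<kappa>)"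
    using assms unfolding tangent_space_def cotangent_space_def by blast+
  thus ?thesis by (simp add: pairing_def Let_def \<kappa>0_def[symmetric])
qed

lemma pairing_linear:
  "pairing A x (\<lambda>\<kappa> e. \<Sum>j\<in>I. a j * \<alpha> j \<kappa> e) X = (\<Sum>j\<in>I. a j * pairing A x (\<alpha> j) X)"
  by (simp add: pairing_def Let_def)

lemma smooth_in_const: "smooth_in \<kappa> W (\<lambda>z. c)"
  by (simp add: smooth_in_def smooth_on_const)

lemma smooth_in_mono: "smooth_in \<kappa> W f \<Longrightarrow> W' \<subseteq> W \<Longrightarrow> smooth_in \<kappa> W' f"
  unfolding smooth_in_def by (rule smooth_on_mono) auto

section \<open>Calculus in the charts of a fixed manifold\<close>

locale manifold =
  fixes A :: "('m::{t2_space, second_countable_topology}, 'e::real_normed_vector) chart set"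
  assumes manifold: "smooth_manifold A"
begin

lemma fin_dim: "\<exists>B :: 'e set. finite B \<and> span B = UNIV"
  using manifold by (simp add: smooth_manifold_def)

lemma chart: "\<kappa> \<in> A \<Longrightarrow> is_chart \<kappa>"
  using manifold by (simp add: smooth_manifold_def)

lemma chart_inv_chart [simp]: "\<kappa> \<in> A \<Longrightarrow> x \<in> fst \<kappa> \<Longrightarrow> chart_inv \<kappa> (snd \<kappa> x) = x"
  using chart[of \<kappa>] by (simp add: is_chart_def homeomorphism_def)

lemma open_points: "open (points A)"
  unfolding points_def using chart by (auto simp: is_chart_def)

lemma fst_subset_points: "\<kappa> \<in> A \<Longrightarrow> fst \<kappa> \<subseteq> points A"
  by (auto simp: points_def)

lemma open_image:
  assumes "\<kappa> \<in> A" "open W"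
  shows "open (snd \<kappa> ` (fst \<kappa> \<inter> W))"
proof -
  note ch = chart[OF assms(1), unfolded is_chart_def]
  have c: "continuous_on (snd \<kappa> ` fst \<kappa>) (chart_inv \<kappa>)"
    using ch unfolding homeomorphism_def by (elim conjE)
  have "open (chart_inv \<kappa> -` W \<inter> snd \<kappa> ` fst \<kappa>)"
    by (rule continuous_on_open_vimage[THEN iffD1, rule_format, OF _ c assms(2)]) (use ch in \<open>elim conjE\<close>)
  moreover have "chart_inv \<kappa> -` W \<inter> snd \<kappa> ` fst \<kappa> = snd \<kappa> ` (fst \<kappa> \<inter> W)"
    by (intro equalityI subsetI; elim IntE imageE vimageE; simp add: assms(1))
  ultimately show ?thesis by (rule back_subst)
qed

lemma smooth_in_cong:
  assumes "\<kappa> \<in> A" "open W" "smooth_in \<kappa> W f" "\<And>z. z \<in> fst \<kappa> \<Longrightarrow> z \<in> W \<Longrightarrow> f z = g z"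
  shows "smooth_in \<kappa> W g"
  unfolding smooth_in_def
  by (rule smooth_on_cong[OF open_image[OF assms(1,2)] _ assms(3)[unfolded smooth_in_def]])
     (use assms in auto)

lemma smooth_in_add:
  "\<kappa> \<in> A \<Longrightarrow> open W \<Longrightarrow> smooth_in \<kappa> W f \<Longrightarrow> smooth_in \<kappa> W g \<Longrightarrow> smooth_in \<kappa> W (\<lambda>z. f z + g z)"
  unfolding smooth_in_def by (rule smooth_on_add[OF open_image])

lemma smooth_in_diff:
  "\<kappa> \<in> A \<Longrightarrow> open W \<Longrightarrow> smooth_in \<kappa> W f \<Longrightarrow> smooth_in \<kappa> W g \<Longrightarrow> smooth_in \<kappa> W (\<lambda>z. f z - g z)"
  unfolding smooth_in_def by (rule smooth_on_diff[OF open_image])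

lemma smooth_in_mult:
  fixes f g :: "'m \<Rightarrow> real"
  shows "\<kappa> \<in> A \<Longrightarrow> open W \<Longrightarrow> smooth_in \<kappa> W f \<Longrightarrow> smooth_in \<kappa> W g \<Longrightarrow> smooth_in \<kappa> W (\<lambda>z. f z * g z)"
  unfolding smooth_in_def by (rule smooth_on_mult[OF open_image])

lemma smooth_in_scaleR:
  "\<kappa> \<in> A \<Longrightarrow> open W \<Longrightarrow> smooth_in \<kappa> W f \<Longrightarrow> smooth_in \<kappa> W g \<Longrightarrow> smooth_in \<kappa> W (\<lambda>z. f z *\<^sub>R g z)"
  unfolding smooth_in_def by (rule smooth_on_scaleR[OF open_image])

lemma smooth_in_sum:
  "\<kappa> \<in> A \<Longrightarrow> open W \<Longrightarrow> (\<And>i. i \<in> I \<Longrightarrow> smooth_in \<kappa> W (f i)) \<Longrightarrow> smooth_in \<kappa> W (\<lambda>z. \<Sum>i\<in>I. f i z)"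
  unfolding smooth_in_def by (rule smooth_on_sum[OF open_image])

lemma smooth_in_apply:
  fixes F :: "'m \<Rightarrow> 'e \<Rightarrow> 'f::real_normed_vector"
  assumes "\<kappa> \<in> A" "open W" "\<And>e. smooth_in \<kappa> W (\<lambda>z. F z e)"
    "\<And>z. z \<in> fst \<kappa> \<Longrightarrow> z \<in> W \<Longrightarrow> linear (F z)" "smooth_in \<kappa> W X"
  shows "smooth_in \<kappa> W (\<lambda>z. F z (X z))"
  unfolding smooth_in_def
  by (rule smooth_on_apply[OF fin_dim open_image[OF assms(1,2)]])
     (use assms in \<open>auto simp: smooth_in_def\<close>)

lemma has_loc_deriv:
  assumes "smooth_in \<kappa> W f" "x \<in> fst \<kappa>" "x \<in> W"
  shows "((\<lambda>y. f (chart_inv \<kappa> y)) has_derivative loc_deriv \<kappa> x f) (at (snd \<kappa> x))"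
  using smooth_on_has_derivative[OF assms(1)[unfolded smooth_in_def], of "snd \<kappa> x"] assms(2,3)
  by (simp add: loc_deriv_def)

lemma linear_loc_deriv:
  "smooth_in \<kappa> W f \<Longrightarrow> x \<in> fst \<kappa> \<Longrightarrow> x \<in> W \<Longrightarrow> linear (loc_deriv \<kappa> x f)"
  by (rule has_derivative_linear[OF has_loc_deriv])

text \<open>\<open>f\<close> is the explicit expression with a known derivative \<open>D\<close>;
  \<open>g\<close> is typically written with \<open>pairing\<close> or \<open>hat\<close> and
  coincides with it only over the part of \<open>W\<close> inside the chart.\<close>

lemma loc_deriv_eqI:
  assumes "\<kappa> \<in> A" "open W" "x \<in> fst \<kappa>" "x \<in> W" "\<And>z. z \<in> fst \<kappa> \<Longrightarrow> z \<in> W \<Longrightarrow> g z = f z"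
    "((\<lambda>y. f (chart_inv \<kappa> y)) has_derivative D) (at (snd \<kappa> x))"
  shows "loc_deriv \<kappa> x g = D"
proof -
  have "((\<lambda>y. g (chart_inv \<kappa> y)) has_derivative D) (at (snd \<kappa> x))"
    by (rule has_derivative_transform_within_open[OF assms(6) open_image[OF assms(1,2)]])
       (use assms in auto)
  thus ?thesis unfolding loc_deriv_def by (rule frechet_derivative_at[symmetric])
qed

lemma loc_deriv_cong:
  assumes "\<kappa> \<in> A" "open W" "x \<in> fst \<kappa>" "x \<in> W" "\<And>z. z \<in> fst \<kappa> \<Longrightarrow> z \<in> W \<Longrightarrow> g z = f z"
    "smooth_in \<kappa> W f"
  shows "loc_deriv \<kappa> x g = loc_deriv \<kappa> x f"
  by (rule loc_deriv_eqI[OF assms(1-5) has_loc_deriv[OF assms(6,3,4)]])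

lemma has_derivative_loc_apply:
  fixes F :: "'m \<Rightarrow> 'e \<Rightarrow> 'f::real_normed_vector"
  assumes "\<kappa> \<in> A" "open W" "x \<in> fst \<kappa>" "x \<in> W" "\<And>e. smooth_in \<kappa> W (\<lambda>z. F z e)"
    "\<And>z. z \<in> fst \<kappa> \<Longrightarrow> z \<in> W \<Longrightarrow> linear (F z)" "smooth_in \<kappa> W X"
  shows "((\<lambda>y. F (chart_inv \<kappa> y) (X (chart_inv \<kappa> y))) has_derivative
    (\<lambda>e. loc_deriv \<kappa> x (\<lambda>z. F z (X x)) e + F x (loc_deriv \<kappa> x X e))) (at (snd \<kappa> x))"
proof -
  have "((\<lambda>y. F (chart_inv \<kappa> y) (X (chart_inv \<kappa> y))) has_derivative
    (\<lambda>e. frechet_derivative (\<lambda>y. F (chart_inv \<kappa> y) (X (chart_inv \<kappa> (snd \<kappa> x)))) (at (snd \<kappa> x)) e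
      + F (chart_inv \<kappa> (snd \<kappa> x)) (frechet_derivative (\<lambda>y. X (chart_inv \<kappa> y)) (at (snd \<kappa> x)) e)))
    (at (snd \<kappa> x))"
    by (rule has_derivative_apply[OF fin_dim open_image[OF assms(1,2)]])
       (use assms in \<open>auto simp: smooth_in_def\<close>)
  thus ?thesis using assms(1,3) by (simp add: loc_deriv_def)
qed

lemma smooth_in_loc_deriv:
  assumes "\<kappa> \<in> A" "open W" "smooth_in \<kappa> W f" "smooth_in \<kappa> W X"
  shows "smooth_in \<kappa> W (\<lambda>z. loc_deriv \<kappa> z f (X z))"
proof (rule smooth_in_apply[OF assms(1,2) _ _ assms(4)])
  show "smooth_in \<kappa> W (\<lambda>z. loc_deriv \<kappa> z f e)" for e
    unfolding smooth_in_def loc_deriv_def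
    by (rule smooth_on_cong[OF open_image[OF assms(1,2)] _ 
          smooth_on_deriv[OF assms(3)[unfolded smooth_in_def]]]) (use assms(1) in auto)
qed (rule linear_loc_deriv[OF assms(3)])

lemma linear_loc_deriv_form:
  fixes F :: "'m \<Rightarrow> 'e \<Rightarrow> real"
  assumes "\<kappa> \<in> A" "open W" "x \<in> fst \<kappa>" "x \<in> W" "\<And>e. smooth_in \<kappa> W (\<lambda>z. F z e)"
    "\<And>z. z \<in> fst \<kappa> \<Longrightarrow> z \<in> W \<Longrightarrow> linear (F z)"
  shows "linear (\<lambda>v. loc_deriv \<kappa> x (\<lambda>z. F z v) e)"
proof (rule linearI)
  note d = has_loc_deriv[OF assms(5,3,4)]
  show "loc_deriv \<kappa> x (\<lambda>z. F z (a + b)) e = loc_deriv \<kappa> x (\<lambda>z. F z a) e + loc_deriv \<kappa> x (\<lambda>z. F z b) e" for a b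
    by (subst loc_deriv_eqI[OF assms(1-4) _ has_derivative_add[OF d[of a] d[of b]]])
       (use assms(6) in \<open>auto simp: linear_add\<close>)
  show "loc_deriv \<kappa> x (\<lambda>z. F z (r *\<^sub>R a)) e = r *\<^sub>R loc_deriv \<kappa> x (\<lambda>z. F z a) e" for a r
    by (subst loc_deriv_eqI[OF assms(1-4) _ has_derivative_scaleR_right[OF d[of a], of r]])
       (use assms(6) in \<open>auto simp: linear_scale\<close>)
qed

text \<open>\<open>deriv_along\<close> evaluates the differential in an arbitrarily chosen chart. By
  the chain rule for the transition map, differential and vector component change by the same
  Jacobian, so every chart around x gives the same value.\<close>

lemma deriv_along_eq:
  assumes "open W" "smooth_fun A W f" "x \<in> W" "X x \<in> tangent_space A x" "\<kappa> \<in> charts_at A x"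
  shows "deriv_along A X f x = loc_deriv \<kappa> x f (X x \<kappa>)"
proof -
  define \<kappa>0 where "\<kappa>0 = (SOME \<kappa>. \<kappa> \<in> charts_at A x)"
  have \<kappa>0: "\<kappa>0 \<in> charts_at A x" unfolding \<kappa>0_def using assms(5) by (rule someI)
  have in_A: "\<kappa> \<in> A" "\<kappa>0 \<in> A" "x \<in> fst \<kappa>" "x \<in> fst \<kappa>0" using \<kappa>0 assms(5) by (auto simp: charts_at_iff)
  have X: "X x \<kappa>0 = frechet_derivative (transition \<kappa> \<kappa>0) (at (snd \<kappa> x)) (X x \<kappa>)"
    using assms(4,5) \<kappa>0 unfolding tangent_space_def by blast
  have op: "open (fst \<kappa>0)" using chart[OF in_A(2)] by (simp add: is_chart_def)
  have "smooth_on (snd \<kappa> ` (fst \<kappa> \<inter> fst \<kappa>0)) (transition \<kappa> \<kappa>0)"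
    using manifold in_A by (simp add: smooth_manifold_def)
  hence t: "(transition \<kappa> \<kappa>0 has_derivative frechet_derivative (transition \<kappa> \<kappa>0) (at (snd \<kappa> x))) (at (snd \<kappa> x))"
    by (rule smooth_on_has_derivative) (use in_A in auto)
  have tx: "transition \<kappa> \<kappa>0 (snd \<kappa> x) = snd \<kappa>0 x" using in_A by (simp add: transition_def)
  have "((\<lambda>y. f (chart_inv \<kappa>0 y)) has_derivative loc_deriv \<kappa>0 x f) (at (snd \<kappa>0 x))"
    by (rule has_loc_deriv) (use assms in_A in \<open>auto simp: smooth_fun_iff\<close>)
  hence "((\<lambda>y. f (chart_inv \<kappa>0 (transition \<kappa> \<kappa>0 y))) has_derivative 
      (\<lambda>e. loc_deriv \<kappa>0 x f (frechet_derivative (transition \<kappa> \<kappa>0) (at (snd \<kappa> x)) e))) (at (snd \<kappa> x))"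
    using diff_chain_at[OF t, of "\<lambda>y. f (chart_inv \<kappa>0 y)"] by (simp add: tx o_def)
  \<comment> \<open>Passing through the chart \<open>\<kappa>0\<close> and back is the identity on
    its domain, so this inner function agrees with \<open>f\<close> near x and has the same
    coordinate derivative.\<close>
  hence "((\<lambda>y. (\<lambda>z. f (chart_inv \<kappa>0 (snd \<kappa>0 z))) (chart_inv \<kappa> y)) has_derivative 
      (\<lambda>e. loc_deriv \<kappa>0 x f (frechet_derivative (transition \<kappa> \<kappa>0) (at (snd \<kappa> x)) e))) (at (snd \<kappa> x))"
    by (simp add: transition_def)
  hence "loc_deriv \<kappa> x f = (\<lambda>e. loc_deriv \<kappa>0 x f (frechet_derivative (transition \<kappa> \<kappa>0) (at (snd \<kappa> x)) e))"
    by (rule loc_deriv_eqI[OF in_A(1) op in_A(3,4), rotated]) (simp add: in_A(2))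
  thus ?thesis
    by (simp add: deriv_along_def pairing_def Let_def \<kappa>0_def[symmetric] differential_eq[OF \<kappa>0] X)
qed

lemma smooth_fun_deriv_along:
  assumes "open W" "smooth_fun A W f" "vector_field A W X"
  shows "smooth_fun A W (deriv_along A X f)"
  unfolding smooth_fun_iff
proof
  fix \<kappa> assume \<kappa>: "\<kappa> \<in> A"
  have "smooth_in \<kappa> W (\<lambda>z. loc_deriv \<kappa> z f (X z \<kappa>))"
    by (rule smooth_in_loc_deriv[OF \<kappa> assms(1)])
       (use assms(2,3) \<kappa> in \<open>simp_all add: vector_field_iff smooth_fun_iff\<close>)
  moreover have "loc_deriv \<kappa> z f (X z \<kappa>) = deriv_along A X f z" if "z \<in> fst \<kappa>" "z \<in> W" for z
    by (rule deriv_along_eq[OF assms(1,2), symmetric])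
       (use assms(3) that \<kappa> in \<open>simp_all add: vector_field_iff charts_at_iff\<close>)
  ultimately show "smooth_in \<kappa> W (deriv_along A X f)"
    by (rule smooth_in_cong[OF \<kappa> assms(1)])
qed

lemma pairing_loc_form:
  assumes "one_form A W \<alpha>" "vector_field A W X" "\<kappa> \<in> A" "z \<in> fst \<kappa>" "z \<in> W"
  shows "pairing A z (\<alpha> z) (X z) = \<alpha> z \<kappa> (X z \<kappa>)"
  by (rule pairing_eq) (use assms in \<open>simp_all add: vector_field_iff one_form_iff charts_at_iff\<close>)

lemma linear_one_form:
  assumes "one_form A W \<alpha>" "\<kappa> \<in> A" "z \<in> fst \<kappa>" "z \<in> W"
  shows "linear (\<alpha> z \<kappa>)"
  by (rule linear_loc_form) (use assms in \<open>simp_all add: one_form_iff charts_at_iff\<close>)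

lemma smooth_fun_pairing:
  assumes "open W" "one_form A W \<alpha>" "vector_field A W X"
  shows "smooth_fun A W (\<lambda>z. pairing A z (\<alpha> z) (X z))"
  unfolding smooth_fun_iff
proof
  fix \<kappa> assume \<kappa>: "\<kappa> \<in> A"
  have "smooth_in \<kappa> W (\<lambda>z. \<alpha> z \<kappa> (X z \<kappa>))"
    by (rule smooth_in_apply[OF \<kappa> assms(1) _ linear_one_form[OF assms(2) \<kappa>]])
       (use assms \<kappa> in \<open>simp_all add: vector_field_iff one_form_iff\<close>)
  thus "smooth_in \<kappa> W (\<lambda>z. pairing A z (\<alpha> z) (X z))"
    by (rule smooth_in_cong[OF \<kappa> assms(1)]) (rule pairing_loc_form[OF assms(2,3) \<kappa>, symmetric])
qed

text \<open>It is used twice: for the differential of \<alpha>1(X2) - \<alpha>2(X1) in the bracket,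
  and for the derivatives of the new u-entries \<alpha>(V).\<close>

lemma loc_deriv_pairing:
  assumes "open W" "one_form A W \<alpha>" "vector_field A W X" "x \<in> W" "\<kappa> \<in> A" "x \<in> fst \<kappa>"
  shows "loc_deriv \<kappa> x (\<lambda>z. pairing A z (\<alpha> z) (X z)) e =
      loc_deriv \<kappa> x (\<lambda>z. \<alpha> z \<kappa> (X x \<kappa>)) e + \<alpha> x \<kappa> (loc_deriv \<kappa> x (\<lambda>z. X z \<kappa>) e)"
proof -
  have "((\<lambda>y. \<alpha> (chart_inv \<kappa> y) \<kappa> (X (chart_inv \<kappa> y) \<kappa>)) has_derivative
      (\<lambda>e. loc_deriv \<kappa> x (\<lambda>z. \<alpha> z \<kappa> (X x \<kappa>)) e + \<alpha> x \<kappa> (loc_deriv \<kappa> x (\<lambda>z. X z \<kappa>) e))) (at (snd \<kappa> x))"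
    by (rule has_derivative_loc_apply[OF assms(5,1,6,4) _ linear_one_form[OF assms(2,5)]])
       (use assms in \<open>simp_all add: vector_field_iff one_form_iff\<close>)
  thus ?thesis
    by (subst loc_deriv_eqI[OF assms(5,1,6,4) pairing_loc_form[OF assms(2,3,5)]]) auto
qed

end

section \<open>The fibres of the enlarged structure\<close>

text \<open>\<open>hat A h k V x w s\<close> is the element of the enlarged structure over \<open>x\<close> built from \<open>s \<in> J x\<close> and
  \<open>w \<in> \<real>\<^sup>k\<close>; \<open>unhat\<close> recovers \<open>s\<close>.\<close>

definition hat :: "('m, 'e::real_normed_vector) chart set \<Rightarrow> nat \<Rightarrow> nat \<Rightarrow> (nat \<Rightarrow> 'm \<Rightarrow> ('m, 'e) tvec) \<Rightarrow>
    'm \<Rightarrow> (nat \<Rightarrow> real) \<Rightarrow> ('m, 'e) big \<Rightarrow> ('m, 'e) big"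
  where "hat A h k V x w s = Big
    (\<lambda>\<kappa>. vecX s \<kappa> - (\<Sum>p<k. w p *\<^sub>R V p x \<kappa>))
    (vec_append h (vecu s) (\<lambda>p. if p < k then pairing A x (forma s) (V p x) else 0))
    (forma s)
    (vec_append h (vecv s) w)"

definition unhat :: "nat \<Rightarrow> nat \<Rightarrow> (nat \<Rightarrow> 'm \<Rightarrow> ('m, 'e::real_normed_vector) tvec) \<Rightarrow>
    'm \<Rightarrow> ('m, 'e) big \<Rightarrow> ('m, 'e) big"
  where "unhat h k V x t = Big
    (\<lambda>\<kappa>. vecX t \<kappa> + (\<Sum>p<k. vecv t (h + p) *\<^sub>R V p x \<kappa>))
    (vec_take h (vecu t)) (forma t) (vec_take h (vecv t))"

lemma big_fibre_iff: "s \<in> big_fibre A h x \<longleftrightarrow>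
    vecX s \<in> tangent_space A x \<and> vecu s \<in> rvec h \<and> forma s \<in> cotangent_space A x \<and> vecv s \<in> rvec h"
  by (cases s) (auto simp: big_fibre_def)

lemma dot_append:
  "dot (h + k) (vec_append h u u') (vec_append h v v') = dot h u v + dot k u' v'"
  by (induction k) (auto simp: dot_def vec_append_def)

lemma vec_append_rvec: "u' \<in> rvec k \<Longrightarrow> vec_append h u u' \<in> rvec (h + k)"
  by (auto simp: rvec_def vec_append_def)

lemma lin_comb_hat:
  "lin_comb r a (\<lambda>j. hat A h k V x (w j) (s j)) =
     hat A h k V x (\<lambda>p. \<Sum>j<r. a j * w j p) (lin_comb r a s)"
proof -
  have "(\<Sum>j<r. a j *\<^sub>R (\<Sum>p<k. w j p *\<^sub>R V p x \<kappa>)) = (\<Sum>p<k. (\<Sum>j<r. a j * w j p) *\<^sub>R V p x \<kappa>)" for \<kappa>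
    by (simp add: scaleR_sum_right scaleR_sum_left) (rule sum.swap)
  thus ?thesis
    by (auto simp: lin_comb_def hat_def vec_append_def pairing_linear fun_eq_iff
        scaleR_right_diff_distrib sum_subtractf)
qed

lemma unhat_hat: "s \<in> big_fibre A h x \<Longrightarrow> unhat h k V x (hat A h k V x w s) = s"
  by (cases s) (auto simp: big_fibre_iff unhat_def hat_def vec_take_def vec_append_def rvec_def fun_eq_iff)

lemma vecv_hat: "vecv (hat A h k V x w s) (h + p) = w p"
  by (simp add: hat_def vec_append_def)

text \<open>The condition on the last u-entries says that t is G-orthogonal to the elements
  \<open>hat e\<^sub>p 0\<close> with \<open>e\<^sub>p\<close> a unit vector. So the image of
  \<open>hat\<close> is the orthogonal complement of these.\<close>

lemma hat_unhat:
  assumes "t \<in> big_fibre A (h + k) x" "\<And>p. p < k \<Longrightarrow> vecu t (h + p) = pairing A x (forma t) (V p x)"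
  shows "hat A h k V x (\<lambda>p. vecv t (h + p)) (unhat h k V x t) = t"
proof -
  have "vecu t a = pairing A x (forma t) (V (a - h) x)" if "\<not> a < h" "a - h < k" for a
    using assms(2)[OF that(2)] that(1) by simp
  moreover have "vecu t a = 0" if "\<not> a < h" "\<not> a - h < k" for a
    using assms(1) that by (auto simp: big_fibre_iff rvec_def)
  ultimately show ?thesis
    by (cases t) (auto simp: unhat_def hat_def vec_take_def vec_append_def fun_eq_iff)
qed

lemma lin_comb_0: "lin_comb 0 a s = big_zero"
  by (simp add: lin_comb_def big_zero_def)

lemma pairing_comb:
  assumes "\<alpha> \<in> cotangent_space A x" "x \<in> points A"
  shows "pairing A x \<alpha> (\<lambda>\<kappa>. X \<kappa> - (\<Sum>p<k. w p *\<^sub>R Y p \<kappa>)) =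
    pairing A x \<alpha> X - (\<Sum>p<k. w p * pairing A x \<alpha> (Y p))"
proof -
  have "(SOME \<kappa>. \<kappa> \<in> charts_at A x) \<in> charts_at A x"
    by (rule someI_ex) (use assms(2) in \<open>auto simp: points_def charts_at_def\<close>)
  with linear_loc_form[OF assms(1)] show ?thesis
    by (simp add: pairing_def Let_def linear_diff linear_sum linear_scale)
qed

text \<open>The term -w \<cdot> \<alpha>(V) that the shift of the vector part contributes is
  cancelled by the product of the new u-block \<alpha>(V) with the new v-block w; this happens once
  for each of the two elements.\<close>

lemma metricG_hat:
  assumes "s \<in> big_fibre A h x" "t \<in> big_fibre A h x" "x \<in> points A"
  shows "metricG A (h + k) x (hat A h k V x w s) (hat A h k V x w' t) = metricG A h x s t"
proof -
  have "forma s \<in> cotangent_space A x" "forma t \<in> cotangent_space A x"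
    using assms(1,2) by (auto simp: big_fibre_iff)
  thus ?thesis using assms(3)
    by (simp add: metricG_def hat_def dot_append pairing_comb) (simp add: dot_def mult.commute)
qed

lemma vector_field_mono: "vector_field A W X \<Longrightarrow> W' \<subseteq> W \<Longrightarrow> vector_field A W' X"
  by (auto simp: vector_field_iff intro: smooth_in_mono)

lemma smooth_fun_const: "smooth_fun A W (\<lambda>z. c)"
  by (simp add: smooth_fun_iff smooth_in_const)

section \<open>Linear structure of tangent and cotangent spaces\<close>

lemma (in manifold) linear_transition:
  assumes "\<kappa> \<in> charts_at A x" "\<kappa>' \<in> charts_at A x"
  shows "linear (frechet_derivative (transition \<kappa> \<kappa>') (at (snd \<kappa> x)))"
proof -
  have in_A: "\<kappa> \<in> A" "\<kappa>' \<in> A" "x \<in> fst \<kappa>" "x \<in> fst \<kappa>'" using assms by (auto simp: charts_at_iff)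
  have "smooth_on (snd \<kappa> ` (fst \<kappa> \<inter> fst \<kappa>')) (transition \<kappa> \<kappa>')"
    using manifold in_A by (simp add: smooth_manifold_def)
  thus ?thesis
    by (rule has_derivative_linear[OF smooth_on_has_derivative]) (use in_A in auto)
qed

lemma tangent_spaceI:
  assumes "\<And>\<kappa> \<kappa>'. \<kappa> \<in> charts_at A x \<Longrightarrow> \<kappa>' \<in> charts_at A x \<Longrightarrow>
      X \<kappa>' = frechet_derivative (transition \<kappa> \<kappa>') (at (snd \<kappa> x)) (X \<kappa>)"
    "\<And>\<kappa>. \<kappa> \<notin> charts_at A x \<Longrightarrow> X \<kappa> = 0"
  shows "X \<in> tangent_space A x"
  using assms unfolding tangent_space_def by blast

lemma (in manifold) tangent_space_add:
  assumes "X \<in> tangent_space A x" "Y \<in> tangent_space A x"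
  shows "(\<lambda>\<kappa>. X \<kappa> + Y \<kappa>) \<in> tangent_space A x"
proof -
  have "X \<kappa>' + Y \<kappa>' = frechet_derivative (transition \<kappa> \<kappa>') (at (snd \<kappa> x)) (X \<kappa> + Y \<kappa>)"
    if "\<kappa> \<in> charts_at A x" "\<kappa>' \<in> charts_at A x" for \<kappa> \<kappa>'
  proof -
    have "X \<kappa>' = frechet_derivative (transition \<kappa> \<kappa>') (at (snd \<kappa> x)) (X \<kappa>)"
      "Y \<kappa>' = frechet_derivative (transition \<kappa> \<kappa>') (at (snd \<kappa> x)) (Y \<kappa>)"
      using assms that unfolding tangent_space_def by blast+
    thus ?thesis by (simp only: linear_add[OF linear_transition[OF that]])
  qed
  thus ?thesis
    by (rule tangent_spaceI) (simp_all add: off_charts_space(1)[OF _ assms(1)] off_charts_space(1)[OF _ assms(2)])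
qed

lemma (in manifold) tangent_space_scale:
  assumes "X \<in> tangent_space A x"
  shows "(\<lambda>\<kappa>. r *\<^sub>R X \<kappa>) \<in> tangent_space A x"
proof -
  have "r *\<^sub>R X \<kappa>' = frechet_derivative (transition \<kappa> \<kappa>') (at (snd \<kappa> x)) (r *\<^sub>R X \<kappa>)"
    if "\<kappa> \<in> charts_at A x" "\<kappa>' \<in> charts_at A x" for \<kappa> \<kappa>'
  proof -
    have "X \<kappa>' = frechet_derivative (transition \<kappa> \<kappa>') (at (snd \<kappa> x)) (X \<kappa>)"
      using assms that unfolding tangent_space_def by blast
    thus ?thesis by (simp only: linear_scale[OF linear_transition[OF that]])
  qed
  thus ?thesis by (rule tangent_spaceI) (simp_all add: off_charts_space(1)[OF _ assms])
qed

lemma (in manifold) tangent_space_zero: "(\<lambda>\<kappa>. 0) \<in> tangent_space A x"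
proof -
  have "frechet_derivative (transition \<kappa> \<kappa>') (at (snd \<kappa> x)) 0 = 0"
    if "\<kappa> \<in> charts_at A x" "\<kappa>' \<in> charts_at A x" for \<kappa> \<kappa>'
    by (rule linear_0[OF linear_transition[OF that]])
  thus ?thesis by (simp add: tangent_space_def)
qed

lemma (in manifold) tangent_space_sum:
  "(\<And>j. j \<in> I \<Longrightarrow> X j \<in> tangent_space A x) \<Longrightarrow> (\<lambda>\<kappa>. \<Sum>j\<in>I. a j *\<^sub>R X j \<kappa>) \<in> tangent_space A x"
proof (induction I rule: infinite_finite_induct)
  case (insert j I)
  have "(\<lambda>\<kappa>. a j *\<^sub>R X j \<kappa> + (\<Sum>i\<in>I. a i *\<^sub>R X i \<kappa>)) \<in> tangent_space A x"
    by (rule tangent_space_add[OF tangent_space_scale insert.IH]) (use insert.prems in auto)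
  thus ?case using insert.hyps by simp
qed (simp_all add: tangent_space_zero)

lemma (in manifold) tangent_space_diff:
  assumes "X \<in> tangent_space A x" "Y \<in> tangent_space A x"
  shows "(\<lambda>\<kappa>. X \<kappa> - Y \<kappa>) \<in> tangent_space A x"
  using tangent_space_add[OF assms(1) tangent_space_scale[OF assms(2), of "-1"]] by simp

lemma cotangent_spaceI:
  assumes "\<And>\<kappa>. \<kappa> \<in> charts_at A x \<Longrightarrow> linear (\<alpha> \<kappa>)"
    "\<And>\<kappa> \<kappa>' e. \<kappa> \<in> charts_at A x \<Longrightarrow> \<kappa>' \<in> charts_at A x \<Longrightarrow>
      \<alpha> \<kappa> e = \<alpha> \<kappa>' (frechet_derivative (transition \<kappa> \<kappa>') (at (snd \<kappa> x)) e)"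
    "\<And>\<kappa> e. \<kappa> \<notin> charts_at A x \<Longrightarrow> \<alpha> \<kappa> e = 0"
  shows "\<alpha> \<in> cotangent_space A x"
  using assms unfolding cotangent_space_def by blast

lemma cotangent_space_sum:
  assumes "\<And>j. j \<in> I \<Longrightarrow> \<alpha> j \<in> cotangent_space A x"
  shows "(\<lambda>\<kappa> e. \<Sum>j\<in>I. a j * \<alpha> j \<kappa> e) \<in> cotangent_space A x"
proof -
  have "linear (\<lambda>e. \<Sum>j\<in>I. a j * \<alpha> j \<kappa> e)" if "\<kappa> \<in> charts_at A x" for \<kappa>
    using linear_loc_form[OF assms that]
    by (intro linearI) (simp_all add: linear_add linear_scale distrib_left sum.distrib sum_distrib_left mult.left_commute)
  moreover have "(\<Sum>j\<in>I. a j * \<alpha> j \<kappa> e) =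
      (\<Sum>j\<in>I. a j * \<alpha> j \<kappa>' (frechet_derivative (transition \<kappa> \<kappa>') (at (snd \<kappa> x)) e))"
    if "\<kappa> \<in> charts_at A x" "\<kappa>' \<in> charts_at A x" for \<kappa> \<kappa>' e
  proof (rule sum.cong)
    fix j assume "j \<in> I"
    from assms[OF this] that have "\<alpha> j \<kappa> e = \<alpha> j \<kappa>' (frechet_derivative (transition \<kappa> \<kappa>') (at (snd \<kappa> x)) e)"
      unfolding cotangent_space_def by blast
    thus "a j * \<alpha> j \<kappa> e = a j * \<alpha> j \<kappa>' (frechet_derivative (transition \<kappa> \<kappa>') (at (snd \<kappa> x)) e)"
      by simp
  qed simp
  moreover have "(\<Sum>j\<in>I. a j * \<alpha> j \<kappa> e) = 0" if "\<kappa> \<notin> charts_at A x" for \<kappa> e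
    using off_charts_space(2)[OF that assms] by (simp add: sum.neutral)
  ultimately show ?thesis by (rule cotangent_spaceI)
qed

section \<open>Fibres and smooth sections under linear combinations, \<open>hat\<close> and
  \<open>unhat\<close>\<close>

context manifold begin

lemma lin_comb_big_fibre:
  assumes "\<And>j. j < r \<Longrightarrow> s j \<in> big_fibre A h x"
  shows "lin_comb r a s \<in> big_fibre A h x"
  using assms tangent_space_sum[of "{..<r}" "\<lambda>j. vecX (s j)" x a]
    cotangent_space_sum[of "{..<r}" "\<lambda>j. forma (s j)" A x a]
  by (simp add: big_fibre_iff lin_comb_def rvec_def)

lemma hat_big_fibre:
  assumes "s \<in> big_fibre A h x" "w \<in> rvec k" "\<And>p. p < k \<Longrightarrow> V p x \<in> tangent_space A x"
  shows "hat A h k V x w s \<in> big_fibre A (h + k) x"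
  using assms tangent_space_diff[OF _ tangent_space_sum[of "{..<k}" "\<lambda>p. V p x" x w], of "vecX s"]
  by (simp add: big_fibre_iff hat_def vec_append_rvec) (auto simp: rvec_def vec_append_def)

lemma unhat_big_fibre:
  assumes "t \<in> big_fibre A (h + k) x" "\<And>p. p < k \<Longrightarrow> V p x \<in> tangent_space A x"
  shows "unhat h k V x t \<in> big_fibre A h x"
  using assms tangent_space_add[OF _ tangent_space_sum[of "{..<k}" "\<lambda>p. V p x" x "\<lambda>p. vecv t (h + p)"], of "vecX t"]
  by (simp add: big_fibre_iff unhat_def) (simp add: rvec_def vec_take_def)

lemma smooth_fun_cong:
  assumes "open W" "smooth_fun A W f" "\<And>z. z \<in> W \<Longrightarrow> f z = g z"
  shows "smooth_fun A W g"
  using assms(2) smooth_in_cong[OF _ assms(1)] assms(3) unfolding smooth_fun_iff by blast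

lemma smooth_fun_add:
  "open W \<Longrightarrow> smooth_fun A W f \<Longrightarrow> smooth_fun A W g \<Longrightarrow> smooth_fun A W (\<lambda>z. f z + g z)"
  by (simp add: smooth_fun_iff smooth_in_add)

lemma smooth_fun_diff:
  "open W \<Longrightarrow> smooth_fun A W f \<Longrightarrow> smooth_fun A W g \<Longrightarrow> smooth_fun A W (\<lambda>z. f z - g z)"
  by (simp add: smooth_fun_iff smooth_in_diff)

lemma smooth_fun_mult:
  fixes f g :: "'m \<Rightarrow> real"
  shows "open W \<Longrightarrow> smooth_fun A W f \<Longrightarrow> smooth_fun A W g \<Longrightarrow> smooth_fun A W (\<lambda>z. f z * g z)"
  by (simp add: smooth_fun_iff smooth_in_mult)

lemma smooth_fun_sum:
  "open W \<Longrightarrow> (\<And>i. i \<in> I \<Longrightarrow> smooth_fun A W (f i)) \<Longrightarrow> smooth_fun A W (\<lambda>z. \<Sum>i\<in>I. f i z)"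
  by (simp add: smooth_fun_iff smooth_in_sum)

lemma big_section_cong:
  assumes "open W" "big_section A h W s" "\<And>z. z \<in> W \<Longrightarrow> s z = t z"
  shows "big_section A h W t"
proof -
  have "smooth_in \<kappa> W (\<lambda>z. vecX (t z) \<kappa>)" if "\<kappa> \<in> A" for \<kappa>
    by (rule smooth_in_cong[OF that assms(1), of "\<lambda>z. vecX (s z) \<kappa>"])
       (use assms that in \<open>auto simp: big_section_def vector_field_iff\<close>)
  moreover have "smooth_in \<kappa> W (\<lambda>z. forma (t z) \<kappa> e)" if "\<kappa> \<in> A" for \<kappa> e
    by (rule smooth_in_cong[OF that assms(1), of "\<lambda>z. forma (s z) \<kappa> e"])
       (use assms that in \<open>auto simp: big_section_def one_form_iff\<close>)
  moreover have "smooth_fun A W (\<lambda>z. vecu (t z) a)" if "a < h" for a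
    by (rule smooth_fun_cong[OF assms(1), of "\<lambda>z. vecu (s z) a"])
       (use assms that in \<open>auto simp: big_section_def\<close>)
  moreover have "smooth_fun A W (\<lambda>z. vecv (t z) a)" if "a < h" for a
    by (rule smooth_fun_cong[OF assms(1), of "\<lambda>z. vecv (s z) a"])
       (use assms that in \<open>auto simp: big_section_def\<close>)
  moreover have "t z \<in> big_fibre A h z" if "z \<in> W" for z
    using assms(2,3) that by (auto simp: big_section_def)
  ultimately show ?thesis
    by (simp add: big_section_def vector_field_iff one_form_iff big_fibre_iff)
qed

lemma big_section_lin_comb:
  assumes "open W" "\<And>j. j < r \<Longrightarrow> big_section A h W (s j)" "\<And>j. j < r \<Longrightarrow> smooth_fun A W (f j)"
  shows "big_section A h W (\<lambda>x. lin_comb r (\<lambda>j. f j x) (\<lambda>j. s j x))"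
proof -
  have f: "smooth_in \<kappa> W (f j)" if "\<kappa> \<in> A" "j < r" for \<kappa> j
    using assms(3) that by (simp add: smooth_fun_iff)
  have s: "smooth_in \<kappa> W (\<lambda>z. vecX (s j z) \<kappa>)" "smooth_in \<kappa> W (\<lambda>z. forma (s j z) \<kappa> e)"
    if "\<kappa> \<in> A" "j < r" for \<kappa> j e
    using assms(2) that by (auto simp: big_section_def vector_field_iff one_form_iff)
  have "lin_comb r (\<lambda>j. f j x) (\<lambda>j. s j x) \<in> big_fibre A h x" if "x \<in> W" for x
    by (rule lin_comb_big_fibre) (use assms(2) that in \<open>auto simp: big_section_def\<close>)
  moreover have "smooth_in \<kappa> W (\<lambda>x. \<Sum>j<r. f j x *\<^sub>R vecX (s j x) \<kappa>)" if "\<kappa> \<in> A" for \<kappa>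
    by (intro smooth_in_sum smooth_in_scaleR that assms(1) f s) auto
  moreover have "smooth_in \<kappa> W (\<lambda>x. \<Sum>j<r. f j x * forma (s j x) \<kappa> e)" if "\<kappa> \<in> A" for \<kappa> e
    by (intro smooth_in_sum smooth_in_mult that assms(1) f s) auto
  moreover have "smooth_fun A W (\<lambda>x. \<Sum>j<r. f j x * vecu (s j x) a)" if "a < h" for a
    using assms(2,3) that by (intro smooth_fun_sum smooth_fun_mult assms(1)) (auto simp: big_section_def)
  moreover have "smooth_fun A W (\<lambda>x. \<Sum>j<r. f j x * vecv (s j x) a)" if "a < h" for a
    using assms(2,3) that by (intro smooth_fun_sum smooth_fun_mult assms(1)) (auto simp: big_section_def)
  ultimately show ?thesis
    by (simp add: big_section_def vector_field_iff one_form_iff big_fibre_iff lin_comb_def)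
qed

lemma big_section_zero: "open W \<Longrightarrow> big_section A h W (\<lambda>x. big_zero)"
  using big_section_lin_comb[of W 0] by (simp add: lin_comb_0)

lemma big_section_hat:
  assumes "open W" "big_section A h W s" "\<And>p. p < k \<Longrightarrow> smooth_fun A W (\<lambda>x. w x p)"
    "\<And>x. x \<in> W \<Longrightarrow> w x \<in> rvec k" "\<And>p. p < k \<Longrightarrow> vector_field A W (V p)"
  shows "big_section A (h + k) W (\<lambda>x. hat A h k V x (w x) (s x))"
proof -
  have "hat A h k V x (w x) (s x) \<in> big_fibre A (h + k) x" if "x \<in> W" for x
    using assms that by (intro hat_big_fibre) (auto simp: big_section_def vector_field_iff)
  moreover have "smooth_in \<kappa> W (\<lambda>x. vecX (s x) \<kappa> - (\<Sum>p<k. w x p *\<^sub>R V p x \<kappa>))" if "\<kappa> \<in> A" for \<kappa>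
    using assms(2,3,5) that by (intro smooth_in_diff smooth_in_sum smooth_in_scaleR that assms(1))
      (auto simp: big_section_def vector_field_iff smooth_fun_iff)
  moreover have "smooth_fun A W (\<lambda>x. vecu (hat A h k V x (w x) (s x)) a)" if "a < h + k" for a
  proof (cases "a < h")
    case True thus ?thesis using assms(2) by (simp add: hat_def vec_append_def big_section_def)
  next
    case False 
    with that have "a - h < k" by simp
    thus ?thesis using assms(1,2,5) False smooth_fun_pairing
      by (simp add: hat_def vec_append_def big_section_def)
  qed
  moreover have "smooth_fun A W (\<lambda>x. vecv (hat A h k V x (w x) (s x)) a)" if "a < h + k" for a
    using assms(2,3) that
    by (cases "a < h") (simp_all add: hat_def vec_append_def big_section_def)
  ultimately show ?thesis using assms(2)
    by (simp add: big_section_def vector_field_iff one_form_iff big_fibre_iff) (simp add: hat_def)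
qed

lemma big_section_unhat:
  assumes "open W" "big_section A (h + k) W t" "\<And>p. p < k \<Longrightarrow> vector_field A W (V p)"
  shows "big_section A h W (\<lambda>x. unhat h k V x (t x))"
proof -
  have "unhat h k V x (t x) \<in> big_fibre A h x" if "x \<in> W" for x
    using assms that by (intro unhat_big_fibre) (auto simp: big_section_def vector_field_iff)
  moreover have "smooth_in \<kappa> W (\<lambda>x. vecX (t x) \<kappa> + (\<Sum>p<k. vecv (t x) (h + p) *\<^sub>R V p x \<kappa>))" if "\<kappa> \<in> A" for \<kappa>
    using assms(2,3) that by (intro smooth_in_add smooth_in_sum smooth_in_scaleR that assms(1))
      (auto simp: big_section_def vector_field_iff smooth_fun_iff)
  ultimately show ?thesis using assms(2)
    by (simp add: big_section_def vector_field_iff one_form_iff big_fibre_iff)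
       (simp add: unhat_def vec_take_def)
qed

end

section \<open>Maximal isotropy and rank of the enlarged structure\<close>

definition hat_bundle :: "('m, 'e::real_normed_vector) chart set \<Rightarrow> nat \<Rightarrow> nat \<Rightarrow> (nat \<Rightarrow> 'm \<Rightarrow> ('m, 'e) tvec) \<Rightarrow>
    ('m \<Rightarrow> ('m, 'e) big set) \<Rightarrow> 'm \<Rightarrow> ('m, 'e) big set"
  where "hat_bundle A h k V J x = {hat A h k V x w s | w s. s \<in> J x \<and> w \<in> rvec k}"

lemma hat_bundleI: "s \<in> J x \<Longrightarrow> w \<in> rvec k \<Longrightarrow> hat A h k V x w s \<in> hat_bundle A h k V J x"
  by (auto simp: hat_bundle_def)

text \<open>Intended for local frames of the enlarged bundle: the k additional frame elements have
  J-part \<open>big_zero\<close>.\<close>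

lemma lin_comb_extend_zero: "lin_comb (r + k) a (\<lambda>j. if j < r then s j else big_zero) = lin_comb r a s"
proof (induction k)
  case 0 thus ?case by (simp add: lin_comb_def cong: sum.cong_simp)
next
  case (Suc k) thus ?case by (simp add: lin_comb_def big_zero_def)
qed

lemma rvec_sum: "(\<And>j. j \<in> I \<Longrightarrow> w j \<in> rvec k) \<Longrightarrow> (\<lambda>p. \<Sum>j\<in>I. a j * w j p) \<in> rvec k"
  by (auto simp: rvec_def intro!: sum.neutral)

lemma pairing_zero: "pairing A x (\<lambda>\<kappa> e. 0) X = 0"
  by (simp add: pairing_def Let_def)

lemma hat_eq_zero:
  assumes "s \<in> big_fibre A h x" "hat A h k V x w s = big_zero"
  shows "s = big_zero" "w = (\<lambda>p. 0)"
proof -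
  show w: "w = (\<lambda>p. 0)"
    using vecv_hat[of A h k V x w s] by (auto simp: assms(2) big_zero_def)
  have "unhat h k V x (big_zero :: ('a, 'b) big) = big_zero"
    by (simp add: unhat_def big_zero_def vec_take_def fun_eq_iff)
  thus "s = big_zero" using unhat_hat[OF assms(1), of k V w] by (simp add: assms(2))
qed

context manifold begin

text \<open>Pairing an element \<open>t\<close> of a larger isotropic space with the elements \<open>hat e\<^sub>p 0\<close> forces its additional
  \<open>u\<close>-entries to be \<open>\<alpha>(V)\<close>, so that \<open>t = hat w s\<close>; the elements \<open>s\<close> arising in this way form an isotropic
  space that contains \<open>J x\<close>.\<close>

lemma maximal_isotropic_hat:
  assumes max: "maximal_isotropic A h x (J x)" and x: "x \<in> points A"
    and V: "\<And>p. p < k \<Longrightarrow> V p x \<in> tangent_space A x"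
  shows "maximal_isotropic A (h + k) x (hat_bundle A h k V J x)"
proof -
  have J: "J x \<subseteq> big_fibre A h x" "\<And>r a s. (\<And>j. j < r \<Longrightarrow> s j \<in> J x) \<Longrightarrow> lin_comb r a s \<in> J x"
    "\<And>s t. s \<in> J x \<Longrightarrow> t \<in> J x \<Longrightarrow> metricG A h x s t = 0"
    using max by (simp_all add: maximal_isotropic_def isotropic_subspace_def)
  have Jmax: "T = J x" if "isotropic_subspace A h x T" "J x \<subseteq> T" for T
    using max that by (simp add: maximal_isotropic_def)
  have zero: "big_zero \<in> J x" using J(2)[of 0] by (simp add: lin_comb_0)
  have fib: "hat A h k V x w s \<in> big_fibre A (h + k) x" if "s \<in> big_fibre A h x" "w \<in> rvec k" for w s
    using that V by (intro hat_big_fibre)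
  have iso: "isotropic_subspace A (h + k) x (hat_bundle A h k V J x)"
    unfolding isotropic_subspace_def
  proof (intro conjI allI ballI impI)
    show "hat_bundle A h k V J x \<subseteq> big_fibre A (h + k) x"
      using J(1) fib by (auto simp: hat_bundle_def)
  next
    fix r :: nat and a s assume "\<forall>j<r. s j \<in> hat_bundle A h k V J x"
    hence "\<forall>j. \<exists>w t. j < r \<longrightarrow> s j = hat A h k V x w t \<and> t \<in> J x \<and> w \<in> rvec k"
      unfolding hat_bundle_def by blast
    then obtain w t where wt: "\<And>j. j < r \<Longrightarrow> s j = hat A h k V x (w j) (t j)"
      "\<And>j. j < r \<Longrightarrow> t j \<in> J x" "\<And>j. j < r \<Longrightarrow> w j \<in> rvec k" by metis
    have "lin_comb r a s = lin_comb r a (\<lambda>j. hat A h k V x (w j) (t j))"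
      unfolding lin_comb_def using wt(1) by (auto intro!: sum.cong ext)
    also have "\<dots> = hat A h k V x (\<lambda>p. \<Sum>j<r. a j * w j p) (lin_comb r a t)"
      by (rule lin_comb_hat)
    also have "\<dots> \<in> hat_bundle A h k V J x"
      using J(2)[of r t a] wt(2,3) by (intro hat_bundleI rvec_sum) auto
    finally show "lin_comb r a s \<in> hat_bundle A h k V J x" .
  next
    fix s t assume "s \<in> hat_bundle A h k V J x" "t \<in> hat_bundle A h k V J x"
    then obtain w s' w' t' where "s = hat A h k V x w s'" "t = hat A h k V x w' t'" "s' \<in> J x" "t' \<in> J x"
      by (auto simp: hat_bundle_def)
    thus "metricG A (h + k) x s t = 0"
      using metricG_hat[OF subsetD[OF J(1)] subsetD[OF J(1)] x, of s' t'] J(3) by simp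
  qed
  moreover have "T = hat_bundle A h k V J x"
    if T: "isotropic_subspace A (h + k) x T" "hat_bundle A h k V J x \<subseteq> T" for T
  proof (rule subset_antisym[OF subsetI T(2)])
    have T_fib: "T \<subseteq> big_fibre A (h + k) x"
      and T_lin: "\<And>r a s. (\<And>j. j < r \<Longrightarrow> s j \<in> T) \<Longrightarrow> lin_comb r a s \<in> T"
      and T_iso: "\<And>s t. s \<in> T \<Longrightarrow> t \<in> T \<Longrightarrow> metricG A (h + k) x s t = 0"
      using T(1) by (simp_all add: isotropic_subspace_def)
    define S where "S = {s \<in> big_fibre A h x. \<exists>w \<in> rvec k. hat A h k V x w s \<in> T}"
    have "isotropic_subspace A h x S"
      unfolding isotropic_subspace_def
    proof (intro conjI allI ballI impI)
      fix r :: nat and a s assume s: "\<forall>j<r. s j \<in> S"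
      hence "\<forall>j. \<exists>w. j < r \<longrightarrow> w \<in> rvec k \<and> hat A h k V x w (s j) \<in> T"
        unfolding S_def by blast
      then obtain w where w: "\<And>j. j < r \<Longrightarrow> w j \<in> rvec k" "\<And>j. j < r \<Longrightarrow> hat A h k V x (w j) (s j) \<in> T"
        by metis
      have "lin_comb r a (\<lambda>j. hat A h k V x (w j) (s j)) \<in> T"
        by (rule T_lin) (rule w(2))
      hence "hat A h k V x (\<lambda>p. \<Sum>j<r. a j * w j p) (lin_comb r a s) \<in> T"
        by (simp only: lin_comb_hat)
      moreover have "(\<lambda>p. \<Sum>j<r. a j * w j p) \<in> rvec k" using w(1) by (intro rvec_sum) auto
      moreover have "lin_comb r a s \<in> big_fibre A h x"
        by (rule lin_comb_big_fibre) (use s in \<open>auto simp: S_def\<close>)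
      ultimately show "lin_comb r a s \<in> S" unfolding S_def by blast
    next
      fix s t assume "s \<in> S" "t \<in> S"
      then obtain w w' where "s \<in> big_fibre A h x" "t \<in> big_fibre A h x"
        "hat A h k V x w s \<in> T" "hat A h k V x w' t \<in> T" unfolding S_def by blast
      thus "metricG A h x s t = 0"
        using metricG_hat[of s A h x t k V w w'] T_iso x by simp
    qed (auto simp: S_def)
    moreover have "J x \<subseteq> S"
    proof
      fix s assume "s \<in> J x"
      hence "hat A h k V x (\<lambda>p. 0) s \<in> hat_bundle A h k V J x"
        by (intro hat_bundleI) (auto simp: rvec_def)
      hence "hat A h k V x (\<lambda>p. 0) s \<in> T" using T(2) by blast
      thus "s \<in> S" using \<open>s \<in> J x\<close> J(1) by (auto simp: S_def rvec_def intro!: bexI[of _ "\<lambda>p. 0"])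
    qed
    ultimately have S: "S = J x" by (rule Jmax)
    fix t assume t: "t \<in> T"
    hence t_fib: "t \<in> big_fibre A (h + k) x" using T_fib by blast
    have u: "vecu t (h + p) = pairing A x (forma t) (V p x)" if "p < k" for p
    proof -
      define w where "w = (\<lambda>q. if q = p then 1 else 0 :: real)"
      define e where "e = hat A h k V x w (big_zero :: ('m, 'e) big)"
      have "w \<in> rvec k" using that by (auto simp: w_def rvec_def)
      hence "e \<in> hat_bundle A h k V J x" using zero unfolding e_def by (intro hat_bundleI)
      hence "metricG A (h + k) x t e = 0"
        using T(2) t by (intro T_iso) auto
      moreover have cot: "forma t \<in> cotangent_space A x" using t_fib by (simp add: big_fibre_iff)
      moreover have "dot (h + k) (vecu t) (vec_append h (\<lambda>i. 0) w) = vecu t (h + p)"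
        unfolding dot_def using that
        by (subst sum.remove[of _ "h + p"])
           (auto simp: vec_append_def w_def intro!: sum.neutral split: if_splits)
      moreover have "dot (h + k) (vec_append h (\<lambda>i. 0) (\<lambda>i. 0)) v = 0" for v
        by (simp add: dot_def vec_append_def)
      moreover have "(\<Sum>q<k. w q * pairing A x (forma t) (V q x)) = pairing A x (forma t) (V p x)"
        using that by (subst sum.remove[of _ p]) (auto simp: w_def intro!: sum.neutral)
      \<comment> \<open>With vanishing \<open>X\<close> and \<open>Y\<close> and a single
        coefficient 1, \<open>pairing_comb\<close> reads \<alpha>(0) = \<alpha>(0) -
        \<alpha>(0).\<close>
      moreover have "pairing A x (forma t) (\<lambda>\<kappa>. 0) = 0"
        using pairing_comb[OF cot x, where X = "\<lambda>\<kappa>. 0" and k = "Suc 0" and w = "\<lambda>p. 1" and Y = "\<lambda>p \<kappa>. 0"]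
        by simp
      moreover have "e = Big (\<lambda>\<kappa>. 0 - (\<Sum>p<k. w p *\<^sub>R V p x \<kappa>)) (vec_append h (\<lambda>i. 0) (\<lambda>p. 0))
          (\<lambda>\<kappa> e. 0) (vec_append h (\<lambda>i. 0) w)"
        by (simp add: e_def hat_def big_zero_def pairing_zero cong: if_cong)
      ultimately show ?thesis
        using pairing_comb[OF cot x, where X = "\<lambda>\<kappa>. 0" and k = k and w = w and Y = "\<lambda>p. V p x"]
        by (simp add: metricG_def pairing_zero)
    qed
    note eq = hat_unhat[where V = V, OF t_fib u]
    have w: "(\<lambda>p. vecv t (h + p)) \<in> rvec k" using t_fib by (auto simp: big_fibre_iff rvec_def)
    have "unhat h k V x t \<in> S"
      unfolding S_def using t w unhat_big_fibre[where V = V, OF t_fib V]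
      by (simp, intro bexI[of _ "\<lambda>p. vecv t (h + p)"]) (simp_all only: eq)
    hence "hat A h k V x (\<lambda>p. vecv t (h + p)) (unhat h k V x t) \<in> hat_bundle A h k V J x"
      using S w by (intro hat_bundleI) auto
    thus "t \<in> hat_bundle A h k V J x" by (simp only: eq)
  qed
  ultimately show ?thesis unfolding maximal_isotropic_def by blast
qed

text \<open>A local frame \<open>s\<close> of \<open>J\<close> gives the frame consisting of
  \<open>hat 0 (s j)\<close> for the first r indices and of \<open>hat e\<^sub>p 0\<close> at index
  \<open>r + p\<close>. It spans because \<open>hat\<close> is linear in both parts together, and it
  is independent because \<open>hat\<close> is injective.\<close>

lemma subbundle_hat:
  assumes sub: "subbundle A h r J" and fib: "\<And>x. x \<in> points A \<Longrightarrow> J x \<subseteq> big_fibre A h x"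
    and V: "\<And>p. p < k \<Longrightarrow> vector_field A (points A) (V p)"
  shows "subbundle A (h + k) (r + k) (hat_bundle A h k V J)"
  unfolding subbundle_def
proof
  fix x assume x: "x \<in> points A"
  obtain W s where W: "open W" "x \<in> W" "W \<subseteq> points A"
    and s: "\<And>j. j < r \<Longrightarrow> big_section A h W (s j)"
    and J: "\<And>y. y \<in> W \<Longrightarrow> J y = {lin_comb r a (\<lambda>j. s j y) | a. a \<in> rvec r}"
    and indep: "\<And>y a j. y \<in> W \<Longrightarrow> lin_comb r a (\<lambda>j. s j y) = big_zero \<Longrightarrow> j < r \<Longrightarrow> a j = 0"
  proof -
    from sub[unfolded subbundle_def, THEN bspec, OF x] obtain W s where
      *: "open W" "x \<in> W" "W \<subseteq> points A" "\<forall>j<r. big_section A h W (s j)"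
        "\<forall>y\<in>W. J y = {lin_comb r a (\<lambda>j. s j y) | a. a \<in> rvec r} \<and>
               (\<forall>a. lin_comb r a (\<lambda>j. s j y) = big_zero \<longrightarrow> (\<forall>j<r. a j = 0))"
      by (elim exE conjE)
    show thesis
      by (rule that[OF *(1-3), of s], use *(4) in simp, use *(5) in simp, use *(5) in blast)
  qed
  \<comment> \<open>Both kinds of frame element in one formula: \<open>w j\<close> is zero for
    \<open>j < r\<close> and the p-th unit vector for \<open>j = r + p\<close>, while
    \<open>s' j\<close> is zero in the second case.\<close>
  define w where "w j = (\<lambda>p. if j = r + p \<and> p < k then 1 else 0 :: real)" for j
  define s' where "s' j = (if j < r then s j else (\<lambda>y. big_zero))" for j
  define t where "t j y = hat A h k V y (w j) (s' j y)" for j y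
  have s': "big_section A h W (s' j)" for j
    using s[of j] big_section_zero[OF W(1)] by (cases "j < r") (simp_all add: s'_def)
  have lin: "lin_comb (r + k) a (\<lambda>j. s' j y) = lin_comb r a (\<lambda>j. s j y)" for a y
    using lin_comb_extend_zero[of r k a "\<lambda>j. s j y"] by (simp add: s'_def if_distrib[of "\<lambda>f. f y"])
  have coef: "(\<Sum>j<r+k. a j * w j p) = (if p < k then a (r + p) else 0)" for a p
    by (cases "p < k", subst sum.remove[of _ "r + p"]) (auto simp: w_def intro!: sum.neutral)
  have t: "lin_comb (r + k) a (\<lambda>j. t j y) =
      hat A h k V y (\<lambda>p. if p < k then a (r + p) else 0) (lin_comb r a (\<lambda>j. s j y))" for a y
    unfolding t_def lin_comb_hat lin coef ..
  have "big_section A (h + k) W (t j)" for j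
    unfolding t_def
    by (rule big_section_hat[OF W(1) s'])
       (use V W(3) in \<open>auto intro: vector_field_mono simp: smooth_fun_const rvec_def w_def\<close>)
  moreover have "hat_bundle A h k V J y = {lin_comb (r + k) a (\<lambda>j. t j y) | a. a \<in> rvec (r + k)}"
    if y: "y \<in> W" for y
  proof (intro equalityI subsetI)
    fix z assume "z \<in> hat_bundle A h k V J y"
    then obtain b a where z: "z = hat A h k V y b (lin_comb r a (\<lambda>j. s j y))" "b \<in> rvec k" "a \<in> rvec r"
      unfolding hat_bundle_def J[OF y] by blast
    have "(\<lambda>p. if p < k then vec_append r a b (r + p) else 0) = b"
      using z(2) by (auto simp: vec_append_def rvec_def)
    moreover have "lin_comb r (vec_append r a b) (\<lambda>j. s j y) = lin_comb r a (\<lambda>j. s j y)"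
      by (simp add: lin_comb_def vec_append_def)
    ultimately have "z = lin_comb (r + k) (vec_append r a b) (\<lambda>j. t j y)"
      by (simp only: t z(1))
    thus "z \<in> {lin_comb (r + k) a (\<lambda>j. t j y) | a. a \<in> rvec (r + k)}"
      using vec_append_rvec[OF z(2)] by blast
  next
    fix z assume "z \<in> {lin_comb (r + k) a (\<lambda>j. t j y) | a. a \<in> rvec (r + k)}"
    then obtain a where z: "z = lin_comb (r + k) a (\<lambda>j. t j y)" by blast
    \<comment> \<open>The fibre of \<open>J\<close> is described by coefficients in
      \<open>rvec r\<close>, whereas \<open>a\<close> may have r + k nonzero entries; truncation
      leaves the combination unchanged.\<close>
    have "lin_comb r a (\<lambda>j. s j y) = lin_comb r (vec_take r a) (\<lambda>j. s j y)"
      by (simp add: lin_comb_def vec_take_def)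
    moreover have "vec_take r a \<in> rvec r" by (simp add: vec_take_def rvec_def)
    ultimately have "lin_comb r a (\<lambda>j. s j y) \<in> J y" unfolding J[OF y] by blast
    thus "z \<in> hat_bundle A h k V J y" unfolding z t by (intro hat_bundleI) (auto simp: rvec_def)
  qed
  moreover have "a j = 0" if "y \<in> W" "lin_comb (r + k) a (\<lambda>j. t j y) = big_zero" "j < r + k" for y a j
  proof -
    have "lin_comb r a (\<lambda>j. s j y) \<in> big_fibre A h y"
      by (rule lin_comb_big_fibre) (use s that(1) in \<open>auto simp: big_section_def\<close>)
    from hat_eq_zero[OF this that(2)[unfolded t]]
    have "lin_comb r a (\<lambda>j. s j y) = big_zero" "\<And>p. p < k \<Longrightarrow> a (r + p) = 0"
      by (auto simp: fun_eq_iff split: if_splits)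
    with indep[OF that(1)] that(3) show ?thesis
      by (cases "j < r") (auto dest: less_imp_add_positive simp: not_less le_iff_add)
  qed
  ultimately show "\<exists>W s. open W \<and> x \<in> W \<and> W \<subseteq> points A \<and> (\<forall>j<r + k. big_section A (h + k) W (s j)) \<and>
        (\<forall>y\<in>W. hat_bundle A h k V J y = {lin_comb (r + k) a (\<lambda>j. s j y) | a. a \<in> rvec (r + k)} \<and>
               (\<forall>a. lin_comb (r + k) a (\<lambda>j. s j y) = big_zero \<longrightarrow> (\<forall>j<r + k. a j = 0)))"
    using W by (intro exI[of _ W] exI[of _ t]) blast
qed

end

section \<open>The bracket\<close>

text \<open>The operation under which \<open>\<Gamma>J\<close> is assumed to be invariant, for \<open>Y = V\<^sub>p\<close>.\<close>

definition twisted_lie :: "('m, 'e::real_normed_vector) chart set \<Rightarrow> nat \<Rightarrow> (nat \<Rightarrow> real) \<Rightarrow>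
    ('m \<Rightarrow> ('m, 'e) tvec) \<Rightarrow> ('m \<Rightarrow> ('m, 'e) big) \<Rightarrow> 'm \<Rightarrow> ('m, 'e) big"
  where "twisted_lie A h c Y s x = Big
     (\<lambda>\<kappa>. lie_bracket A Y (\<lambda>z. vecX (s z)) x \<kappa> + dot h c (vecu (s x)) *\<^sub>R Y x \<kappa>)
     (\<lambda>a. deriv_along A Y (\<lambda>z. vecu (s z) a) x)
     (lie_form A Y (\<lambda>z. forma (s z)) x)
     (\<lambda>a. deriv_along A Y (\<lambda>z. vecv (s z) a) x - pairing A x (forma (s x)) (Y x) * c a)"

lemma sum_split_add:
  fixes f :: "nat \<Rightarrow> 'a::comm_monoid_add"
  shows "(\<Sum>a<h + k. f a) = (\<Sum>a<h. f a) + (\<Sum>p<k. f (h + p))"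
  by (induction k) (simp_all add: add.assoc)

text \<open>The vector component of the bracket at one point, as linear algebra. \<open>L1\<close>,
  \<open>L2\<close> and \<open>N p\<close> stand for the derivatives of the coordinates of X1, X2
  and \<open>V p\<close>, \<open>a2\<close> for the derivatives of w2 along Y1, \<open>a1\<close>
  for those of w1 along Y2, and \<open>c1\<close>, \<open>c2\<close> for c \<cdot> u1 and c \<cdot>
  u2. On the right, the multiples of \<open>c1\<close> and \<open>c2\<close> from \<sigma> cancel
  those from \<omega>.\<close>

lemma hat_bracket_vec:
  fixes X1 X2 :: "'e::real_vector"
  assumes lin: "linear L1" "linear L2" "\<And>p. p < k \<Longrightarrow> linear (N p)"
    and comm: "\<And>p q. p < k \<Longrightarrow> q < k \<Longrightarrow> N q (V p) = N p (V q)"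
    and Y: "Y1 = X1 - (\<Sum>p<k. w1 p *\<^sub>R V p)" "Y2 = X2 - (\<Sum>p<k. w2 p *\<^sub>R V p)"
  shows "(L2 Y1 - (\<Sum>p<k. w2 p *\<^sub>R N p Y1 + a2 p *\<^sub>R V p)) - (L1 Y2 - (\<Sum>p<k. w1 p *\<^sub>R N p Y2 + a1 p *\<^sub>R V p)) =
    (L2 X1 - L1 X2) + (\<Sum>p<k. w2 p *\<^sub>R ((L1 (V p) - N p X1) + c1 *\<^sub>R V p))
      - (\<Sum>p<k. w1 p *\<^sub>R ((L2 (V p) - N p X2) + c2 *\<^sub>R V p))
      - (\<Sum>p<k. (a2 p - a1 p + c1 * w2 p - c2 * w1 p) *\<^sub>R V p)"
proof -
  have NY: "N p (X - (\<Sum>q<k. w q *\<^sub>R V q)) = N p X - (\<Sum>q<k. w q *\<^sub>R N p (V q))" if "p < k" for p X w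
    using lin(3)[OF that] by (simp add: linear_diff linear_sum linear_scale)
  have LY: "L (X - (\<Sum>q<k. w q *\<^sub>R V q)) = L X - (\<Sum>q<k. w q *\<^sub>R L (V q))"
    if "linear L" for L :: "'e \<Rightarrow> 'e" and X w
    using that by (simp add: linear_diff linear_sum linear_scale)
  \<comment> \<open>The terms of second order in w on the two sides of the Lie bracket coincide:
    \<open>comm\<close>, the coordinate form of the vanishing of [V p, V q], exchanges p and q, and
    then the sums are swapped.\<close>
  have "(\<Sum>p<k. w2 p *\<^sub>R (\<Sum>q<k. w1 q *\<^sub>R N p (V q))) = (\<Sum>p<k. \<Sum>q<k. (w2 p * w1 q) *\<^sub>R N q (V p))"
    by (auto simp: scaleR_sum_right comm intro!: sum.cong)
  also have "\<dots> = (\<Sum>q<k. \<Sum>p<k. (w2 p * w1 q) *\<^sub>R N q (V p))" by (rule sum.swap)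
  also have "\<dots> = (\<Sum>p<k. w1 p *\<^sub>R (\<Sum>q<k. w2 q *\<^sub>R N p (V q)))"
    by (simp add: scaleR_sum_right mult.commute)
  finally have sw: "(\<Sum>p<k. w2 p *\<^sub>R (\<Sum>q<k. w1 q *\<^sub>R N p (V q))) =
      (\<Sum>p<k. w1 p *\<^sub>R (\<Sum>q<k. w2 q *\<^sub>R N p (V q)))" .
  have NY1: "(\<Sum>p<k. w2 p *\<^sub>R N p Y1 + a2 p *\<^sub>R V p) = (\<Sum>p<k. w2 p *\<^sub>R N p X1) 
      - (\<Sum>p<k. w2 p *\<^sub>R (\<Sum>q<k. w1 q *\<^sub>R N p (V q))) + (\<Sum>p<k. a2 p *\<^sub>R V p)"
    by (simp add: Y NY scaleR_right_diff_distrib sum.distrib sum_subtractf cong: sum.cong_simp)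
  have NY2: "(\<Sum>p<k. w1 p *\<^sub>R N p Y2 + a1 p *\<^sub>R V p) = (\<Sum>p<k. w1 p *\<^sub>R N p X2) 
      - (\<Sum>p<k. w1 p *\<^sub>R (\<Sum>q<k. w2 q *\<^sub>R N p (V q))) + (\<Sum>p<k. a1 p *\<^sub>R V p)"
    by (simp add: Y NY scaleR_right_diff_distrib sum.distrib sum_subtractf cong: sum.cong_simp)
  show ?thesis unfolding NY1 NY2 unfolding sw unfolding Y LY[OF lin(1)] LY[OF lin(2)]
    by (simp add: scaleR_right_distrib scaleR_right_diff_distrib scaleR_left_distrib scaleR_left_diff_distrib
        sum.distrib sum_subtractf mult.commute algebra_simps)
qed

section \<open>Coordinate expressions at a point\<close>

context manifold begin

lemma loc_deriv_zero:
  assumes "\<kappa> \<in> A" "open W" "x \<in> fst \<kappa>" "x \<in> W" "\<And>z. z \<in> fst \<kappa> \<Longrightarrow> z \<in> W \<Longrightarrow> f z = 0"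
  shows "loc_deriv \<kappa> x f e = 0"
  by (subst loc_deriv_eqI[OF assms(1-4), of f "\<lambda>z. 0" "\<lambda>e. 0"]) (simp_all add: assms(5))

lemma loc_deriv_diff:
  assumes "\<kappa> \<in> A" "open W" "x \<in> fst \<kappa>" "x \<in> W" "smooth_in \<kappa> W f" "smooth_in \<kappa> W g"
  shows "loc_deriv \<kappa> x (\<lambda>z. f z - g z) e = loc_deriv \<kappa> x f e - loc_deriv \<kappa> x g e"
  by (subst loc_deriv_eqI[OF assms(1-4) _ 
        has_derivative_diff[OF has_loc_deriv[OF assms(5,3,4)] has_loc_deriv[OF assms(6,3,4)]]]) simp_all

text \<open>Entries from index \<open>h\<close> on vanish identically on \<open>W\<close>, so
  smoothness holds for every index \<open>a\<close> and later coordinate formulas carry no index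
  bound.\<close>

lemma big_section_smooth:
  assumes "open W" "big_section A h W s"
  shows "smooth_fun A W (\<lambda>z. vecu (s z) a)" "smooth_fun A W (\<lambda>z. vecv (s z) a)"
    "vector_field A W (\<lambda>z. vecX (s z))" "one_form A W (\<lambda>z. forma (s z))"
proof -
  have z: "vecu (s z) a = 0" "vecv (s z) a = 0" if "z \<in> W" "\<not> a < h" for z
    using assms(2) that by (simp_all add: big_section_def big_fibre_iff rvec_def)
  show "smooth_fun A W (\<lambda>z. vecu (s z) a)"
  proof (cases "a < h")
    case True thus ?thesis using assms(2) by (simp add: big_section_def)
  next
    case False show ?thesis
      by (rule smooth_fun_cong[OF assms(1) smooth_fun_const[of A W 0]]) (simp add: z False)
  qed
  show "smooth_fun A W (\<lambda>z. vecv (s z) a)"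
  proof (cases "a < h")
    case True thus ?thesis using assms(2) by (simp add: big_section_def)
  next
    case False show ?thesis
      by (rule smooth_fun_cong[OF assms(1) smooth_fun_const[of A W 0]]) (simp add: z False)
  qed
qed (use assms(2) in \<open>simp_all add: big_section_def\<close>)

lemma wade_bracket_loc:
  fixes s1 s2 :: "'m \<Rightarrow> ('m, 'e) big"
  assumes s: "big_section A h (points A) s1" "big_section A h (points A) s2"
    and \<kappa>: "\<kappa> \<in> A" "x \<in> fst \<kappa>"
  defines "X1 \<equiv> vecX (s1 x) \<kappa>" and "X2 \<equiv> vecX (s2 x) \<kappa>"
    and "\<alpha>1 \<equiv> forma (s1 x) \<kappa>" and "\<alpha>2 \<equiv> forma (s2 x) \<kappa>"
    and "LX1 \<equiv> loc_deriv \<kappa> x (\<lambda>z. vecX (s1 z) \<kappa>)" and "LX2 \<equiv> loc_deriv \<kappa> x (\<lambda>z. vecX (s2 z) \<kappa>)"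
    and "L\<alpha>1 \<equiv> \<lambda>e. loc_deriv \<kappa> x (\<lambda>z. forma (s1 z) \<kappa> e)" and "L\<alpha>2 \<equiv> \<lambda>e. loc_deriv \<kappa> x (\<lambda>z. forma (s2 z) \<kappa> e)"
    and "Lu1 \<equiv> \<lambda>a. loc_deriv \<kappa> x (\<lambda>z. vecu (s1 z) a)" and "Lu2 \<equiv> \<lambda>a. loc_deriv \<kappa> x (\<lambda>z. vecu (s2 z) a)"
    and "Lv1 \<equiv> \<lambda>a. loc_deriv \<kappa> x (\<lambda>z. vecv (s1 z) a)" and "Lv2 \<equiv> \<lambda>a. loc_deriv \<kappa> x (\<lambda>z. vecv (s2 z) a)"
  shows "vecX (wade_bracket A h c s1 s2 x) \<kappa> = LX2 X1 - LX1 X2"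
    and "vecu (wade_bracket A h c s1 s2 x) a = Lu2 a X1 - Lu1 a X2"
    and "forma (wade_bracket A h c s1 s2 x) \<kappa> e = (L\<alpha>2 e X1 + \<alpha>2 (LX1 e)) - (L\<alpha>1 e X2 + \<alpha>1 (LX2 e))
      + (1/2) * ((L\<alpha>1 X2 e + \<alpha>1 (LX2 e)) - (L\<alpha>2 X1 e + \<alpha>2 (LX1 e)))
      + dot h c (vecu (s1 x)) * \<alpha>2 e - dot h c (vecu (s2 x)) * \<alpha>1 e
      + (1/2) * ((\<Sum>a<h. vecu (s2 x) a * Lv1 a e) + (\<Sum>a<h. vecv (s2 x) a * Lu1 a e)
        - (\<Sum>a<h. vecu (s1 x) a * Lv2 a e) - (\<Sum>a<h. vecv (s1 x) a * Lu2 a e))"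
    and "vecv (wade_bracket A h c s1 s2 x) a = Lv2 a X1 - Lv1 a X2
      + (1/2) * (\<alpha>1 X2 - \<alpha>2 X1 + dot h (vecu (s2 x)) (vecv (s1 x)) - dot h (vecu (s1 x)) (vecv (s2 x))) * c a
      + dot h c (vecu (s1 x)) * vecv (s2 x) a - dot h c (vecu (s2 x)) * vecv (s1 x) a"
proof -
  have x: "x \<in> points A" using fst_subset_points \<kappa> by blast
  have \<kappa>x: "\<kappa> \<in> charts_at A x" using \<kappa> by (simp add: charts_at_iff)
  note sm1 = big_section_smooth[OF open_points s(1)] and sm2 = big_section_smooth[OF open_points s(2)]
  have T: "vecX (s1 x) \<in> tangent_space A x" "vecX (s2 x) \<in> tangent_space A x"
    using s x by (simp_all add: big_section_def big_fibre_iff)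
  note da1 = deriv_along_eq[where X = "\<lambda>z. vecX (s1 z)", OF open_points _ x T(1) \<kappa>x]
  note da2 = deriv_along_eq[where X = "\<lambda>z. vecX (s2 z)", OF open_points _ x T(2) \<kappa>x]
  note pr = pairing_loc_form[OF _ _ \<kappa> x]
  have P: "loc_deriv \<kappa> x (\<lambda>z. pairing A z (forma (s1 z)) (vecX (s2 z)) - pairing A z (forma (s2 z)) (vecX (s1 z))) e =
      (L\<alpha>1 X2 e + \<alpha>1 (LX2 e)) - (L\<alpha>2 X1 e + \<alpha>2 (LX1 e))" for e
    using smooth_fun_pairing[OF open_points sm1(4) sm2(3)] smooth_fun_pairing[OF open_points sm2(4) sm1(3)] \<kappa>(1)
    by (simp add: loc_deriv_diff[OF \<kappa>(1) open_points \<kappa>(2) x] smooth_fun_iff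
        loc_deriv_pairing[OF open_points sm1(4) sm2(3) x \<kappa>] loc_deriv_pairing[OF open_points sm2(4) sm1(3) x \<kappa>]
        assms(5-))
  show "vecX (wade_bracket A h c s1 s2 x) \<kappa> = LX2 X1 - LX1 X2"
    by (simp add: wade_bracket_def Let_def lie_bracket_eq[OF \<kappa>x] assms(5-))
  show "vecu (wade_bracket A h c s1 s2 x) a = Lu2 a X1 - Lu1 a X2"
    by (simp add: wade_bracket_def Let_def da1[OF sm2(1)] da2[OF sm1(1)] assms(5-))
  show "forma (wade_bracket A h c s1 s2 x) \<kappa> e = (L\<alpha>2 e X1 + \<alpha>2 (LX1 e)) - (L\<alpha>1 e X2 + \<alpha>1 (LX2 e))
      + (1/2) * ((L\<alpha>1 X2 e + \<alpha>1 (LX2 e)) - (L\<alpha>2 X1 e + \<alpha>2 (LX1 e)))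
      + dot h c (vecu (s1 x)) * \<alpha>2 e - dot h c (vecu (s2 x)) * \<alpha>1 e
      + (1/2) * ((\<Sum>a<h. vecu (s2 x) a * Lv1 a e) + (\<Sum>a<h. vecv (s2 x) a * Lu1 a e)
        - (\<Sum>a<h. vecu (s1 x) a * Lv2 a e) - (\<Sum>a<h. vecv (s1 x) a * Lu2 a e))"
    unfolding wade_bracket_def Let_def big.sel lie_form_eq[OF \<kappa>x] differential_eq[OF \<kappa>x] P
    unfolding assms(5-) ..
  show "vecv (wade_bracket A h c s1 s2 x) a = Lv2 a X1 - Lv1 a X2
      + (1/2) * (\<alpha>1 X2 - \<alpha>2 X1 + dot h (vecu (s2 x)) (vecv (s1 x)) - dot h (vecu (s1 x)) (vecv (s2 x))) * c a
      + dot h c (vecu (s1 x)) * vecv (s2 x) a - dot h c (vecu (s2 x)) * vecv (s1 x) a"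
    by (simp add: wade_bracket_def Let_def da1[OF sm2(2)] da2[OF sm1(2)]
        pr[OF sm1(4) sm2(3)] pr[OF sm2(4) sm1(3)] assms(5-))
qed

lemma twisted_lie_loc:
  fixes s :: "'m \<Rightarrow> ('m, 'e) big"
  assumes s: "big_section A h (points A) s" and Y: "vector_field A (points A) Y"
    and \<kappa>: "\<kappa> \<in> A" "x \<in> fst \<kappa>"
  defines "N \<equiv> loc_deriv \<kappa> x (\<lambda>z. Y z \<kappa>)"
  shows "vecX (twisted_lie A h c Y s x) \<kappa> =
      loc_deriv \<kappa> x (\<lambda>z. vecX (s z) \<kappa>) (Y x \<kappa>) - N (vecX (s x) \<kappa>) + dot h c (vecu (s x)) *\<^sub>R Y x \<kappa>"
    and "vecu (twisted_lie A h c Y s x) a = loc_deriv \<kappa> x (\<lambda>z. vecu (s z) a) (Y x \<kappa>)"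
    and "forma (twisted_lie A h c Y s x) \<kappa> e =
      loc_deriv \<kappa> x (\<lambda>z. forma (s z) \<kappa> e) (Y x \<kappa>) + forma (s x) \<kappa> (N e)"
    and "vecv (twisted_lie A h c Y s x) a =
      loc_deriv \<kappa> x (\<lambda>z. vecv (s z) a) (Y x \<kappa>) - forma (s x) \<kappa> (Y x \<kappa>) * c a"
proof -
  have x: "x \<in> points A" using fst_subset_points \<kappa> by blast
  have \<kappa>x: "\<kappa> \<in> charts_at A x" using \<kappa> by (simp add: charts_at_iff)
  note sm = big_section_smooth[OF open_points s]
  have T: "Y x \<in> tangent_space A x" using Y x by (simp add: vector_field_iff)
  note da = deriv_along_eq[where X = Y, OF open_points _ x T \<kappa>x]
  show "vecX (twisted_lie A h c Y s x) \<kappa> =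
      loc_deriv \<kappa> x (\<lambda>z. vecX (s z) \<kappa>) (Y x \<kappa>) - N (vecX (s x) \<kappa>) + dot h c (vecu (s x)) *\<^sub>R Y x \<kappa>"
    by (simp add: twisted_lie_def lie_bracket_eq[OF \<kappa>x] N_def)
  show "vecu (twisted_lie A h c Y s x) a = loc_deriv \<kappa> x (\<lambda>z. vecu (s z) a) (Y x \<kappa>)"
    by (simp add: twisted_lie_def da[OF sm(1)])
  show "forma (twisted_lie A h c Y s x) \<kappa> e =
      loc_deriv \<kappa> x (\<lambda>z. forma (s z) \<kappa> e) (Y x \<kappa>) + forma (s x) \<kappa> (N e)"
    by (simp add: twisted_lie_def lie_form_eq[OF \<kappa>x] N_def)
  show "vecv (twisted_lie A h c Y s x) a =
      loc_deriv \<kappa> x (\<lambda>z. vecv (s z) a) (Y x \<kappa>) - forma (s x) \<kappa> (Y x \<kappa>) * c a"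
    by (simp add: twisted_lie_def da[OF sm(2)] pairing_loc_form[OF sm(4) Y \<kappa> x])
qed

text \<open>\<open>t\<close> need only agree with \<open>hat\<close> over the points of the
  manifold; these form an open set, so derivatives there are unaffected. The formula for
  \<open>vecu\<close> at \<open>h + p\<close> is the product rule for \<alpha>(V p).\<close>

lemma hat_loc:
  fixes s t :: "'m \<Rightarrow> ('m, 'e) big"
  assumes s: "big_section A h (points A) s"
    and V: "\<And>p. p < k \<Longrightarrow> vector_field A (points A) (V p)"
    and w: "\<And>p. smooth_fun A (points A) (\<lambda>z. w z p)"
    and t: "\<And>z. z \<in> points A \<Longrightarrow> t z = hat A h k V z (w z) (s z)"
    and \<kappa>: "\<kappa> \<in> A" "x \<in> fst \<kappa>"
  shows "loc_deriv \<kappa> x (\<lambda>z. vecX (t z) \<kappa>) e = loc_deriv \<kappa> x (\<lambda>z. vecX (s z) \<kappa>) e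
      - (\<Sum>p<k. w x p *\<^sub>R loc_deriv \<kappa> x (\<lambda>z. V p z \<kappa>) e + loc_deriv \<kappa> x (\<lambda>z. w z p) e *\<^sub>R V p x \<kappa>)"
    and "a < h \<Longrightarrow> loc_deriv \<kappa> x (\<lambda>z. vecu (t z) a) e = loc_deriv \<kappa> x (\<lambda>z. vecu (s z) a) e"
    and "p < k \<Longrightarrow> loc_deriv \<kappa> x (\<lambda>z. vecu (t z) (h + p)) e = 
      loc_deriv \<kappa> x (\<lambda>z. forma (s z) \<kappa> (V p x \<kappa>)) e + forma (s x) \<kappa> (loc_deriv \<kappa> x (\<lambda>z. V p z \<kappa>) e)"
    and "loc_deriv \<kappa> x (\<lambda>z. forma (t z) \<kappa> v) e = loc_deriv \<kappa> x (\<lambda>z. forma (s z) \<kappa> v) e"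
    and "a < h \<Longrightarrow> loc_deriv \<kappa> x (\<lambda>z. vecv (t z) a) e = loc_deriv \<kappa> x (\<lambda>z. vecv (s z) a) e"
    and "loc_deriv \<kappa> x (\<lambda>z. vecv (t z) (h + p)) e = loc_deriv \<kappa> x (\<lambda>z. w z p) e"
proof -
  have x: "x \<in> points A" using fst_subset_points \<kappa> by blast
  note sm = big_section_smooth[OF open_points s]
  note cong = loc_deriv_cong[OF \<kappa>(1) open_points \<kappa>(2) x]
  note d = has_loc_deriv[OF _ \<kappa>(2) x]
  have dw: "((\<lambda>y. w (chart_inv \<kappa> y) p) has_derivative loc_deriv \<kappa> x (\<lambda>z. w z p)) (at (snd \<kappa> x))" for p
    by (rule d) (use w \<kappa>(1) in \<open>simp add: smooth_fun_iff\<close>)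
  have dV: "((\<lambda>y. V p (chart_inv \<kappa> y) \<kappa>) has_derivative loc_deriv \<kappa> x (\<lambda>z. V p z \<kappa>)) (at (snd \<kappa> x))" if "p < k" for p
    by (rule d) (use V[OF that] \<kappa>(1) in \<open>simp add: vector_field_iff\<close>)
  have dX: "((\<lambda>y. vecX (s (chart_inv \<kappa> y)) \<kappa>) has_derivative loc_deriv \<kappa> x (\<lambda>z. vecX (s z) \<kappa>)) (at (snd \<kappa> x))"
    by (rule d) (use sm(3) \<kappa>(1) in \<open>simp add: vector_field_iff\<close>)
  have "((\<lambda>y. (\<lambda>z. vecX (s z) \<kappa> - (\<Sum>p<k. w z p *\<^sub>R V p z \<kappa>)) (chart_inv \<kappa> y)) has_derivative
    (\<lambda>e. loc_deriv \<kappa> x (\<lambda>z. vecX (s z) \<kappa>) e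
      - (\<Sum>p<k. w x p *\<^sub>R loc_deriv \<kappa> x (\<lambda>z. V p z \<kappa>) e + loc_deriv \<kappa> x (\<lambda>z. w z p) e *\<^sub>R V p x \<kappa>)))
    (at (snd \<kappa> x))"
    using has_derivative_diff[OF dX has_derivative_sum[of "{..<k}", OF has_derivative_scaleR[OF dw dV]]] \<kappa>
    by simp
  hence "loc_deriv \<kappa> x (\<lambda>z. vecX (t z) \<kappa>) = (\<lambda>e. loc_deriv \<kappa> x (\<lambda>z. vecX (s z) \<kappa>) e
      - (\<Sum>p<k. w x p *\<^sub>R loc_deriv \<kappa> x (\<lambda>z. V p z \<kappa>) e + loc_deriv \<kappa> x (\<lambda>z. w z p) e *\<^sub>R V p x \<kappa>))"
    by (rule loc_deriv_eqI[OF \<kappa>(1) open_points \<kappa>(2) x, rotated]) (simp add: t hat_def)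
  thus "loc_deriv \<kappa> x (\<lambda>z. vecX (t z) \<kappa>) e = loc_deriv \<kappa> x (\<lambda>z. vecX (s z) \<kappa>) e
      - (\<Sum>p<k. w x p *\<^sub>R loc_deriv \<kappa> x (\<lambda>z. V p z \<kappa>) e + loc_deriv \<kappa> x (\<lambda>z. w z p) e *\<^sub>R V p x \<kappa>)"
    by simp
  show "loc_deriv \<kappa> x (\<lambda>z. vecu (t z) a) e = loc_deriv \<kappa> x (\<lambda>z. vecu (s z) a) e" if "a < h"
    by (rule fun_cong[OF cong])
       (use sm(1) \<kappa>(1) that in \<open>simp_all add: t hat_def vec_append_def smooth_fun_iff\<close>)
  show "loc_deriv \<kappa> x (\<lambda>z. vecu (t z) (h + p)) e = 
      loc_deriv \<kappa> x (\<lambda>z. forma (s z) \<kappa> (V p x \<kappa>)) e + forma (s x) \<kappa> (loc_deriv \<kappa> x (\<lambda>z. V p z \<kappa>) e)" if "p < k"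
  proof -
    have "loc_deriv \<kappa> x (\<lambda>z. vecu (t z) (h + p)) = loc_deriv \<kappa> x (\<lambda>z. pairing A z (forma (s z)) (V p z))"
      by (rule cong) (use smooth_fun_pairing[OF open_points sm(4) V[OF that]] \<kappa>(1) that in
        \<open>simp_all add: t hat_def vec_append_def smooth_fun_iff\<close>)
    thus ?thesis by (simp only: loc_deriv_pairing[OF open_points sm(4) V[OF that] x \<kappa>])
  qed
  show "loc_deriv \<kappa> x (\<lambda>z. forma (t z) \<kappa> v) e = loc_deriv \<kappa> x (\<lambda>z. forma (s z) \<kappa> v) e"
    by (rule fun_cong[OF cong]) (use sm(4) \<kappa>(1) in \<open>simp_all add: t hat_def one_form_iff\<close>)
  show "loc_deriv \<kappa> x (\<lambda>z. vecv (t z) a) e = loc_deriv \<kappa> x (\<lambda>z. vecv (s z) a) e" if "a < h"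
    by (rule fun_cong[OF cong])
       (use sm(2) \<kappa>(1) that in \<open>simp_all add: t hat_def vec_append_def smooth_fun_iff\<close>)
  show "loc_deriv \<kappa> x (\<lambda>z. vecv (t z) (h + p)) e = loc_deriv \<kappa> x (\<lambda>z. w z p) e"
    by (rule fun_cong[OF cong]) (use w \<kappa>(1) in \<open>simp_all add: t hat_def vec_append_def smooth_fun_iff\<close>)
qed

end

text \<open>r + s - t, encoded as a \<open>lin_comb\<close> so that \<sigma> falls under the closure
  of the fibres of \<open>J\<close> and of their sections under linear combinations.\<close>

definition add_diff :: "('m, 'e::real_normed_vector) big \<Rightarrow> ('m, 'e) big \<Rightarrow> ('m, 'e) big \<Rightarrow> ('m, 'e) big"
  where "add_diff r s t = lin_comb 3 (\<lambda>j. if j = 2 then -1 else 1) (\<lambda>j. if j = 0 then r else if j = 1 then s else t)"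

lemma add_diff_sel:
  "vecX (add_diff r s t) \<kappa> = vecX r \<kappa> + vecX s \<kappa> - vecX t \<kappa>"
  "vecu (add_diff r s t) a = vecu r a + vecu s a - vecu t a"
  "forma (add_diff r s t) \<kappa> e = forma r \<kappa> e + forma s \<kappa> e - forma t \<kappa> e"
  "vecv (add_diff r s t) a = vecv r a + vecv s a - vecv t a"
  by (simp_all add: add_diff_def lin_comb_def numeral_3_eq_3)

lemma dot_rvec_append: "c \<in> rvec h \<Longrightarrow> dot (h + k) c (vec_append h u u') = dot h c u"
  unfolding dot_def sum_split_add by (simp add: vec_append_def rvec_def)

lemma lin_comb_sel:
  "vecX (lin_comb r a s) \<kappa> = (\<Sum>j<r. a j *\<^sub>R vecX (s j) \<kappa>)"
  "vecu (lin_comb r a s) i = (\<Sum>j<r. a j * vecu (s j) i)"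
  "forma (lin_comb r a s) \<kappa> e = (\<Sum>j<r. a j * forma (s j) \<kappa> e)"
  "vecv (lin_comb r a s) i = (\<Sum>j<r. a j * vecv (s j) i)"
  by (simp_all add: lin_comb_def)

lemma linear_diff_sum:
  fixes f :: "'a::real_vector \<Rightarrow> real"
  assumes "linear f"
  shows "f (X - (\<Sum>p<k. w p *\<^sub>R Y p)) = f X - (\<Sum>p<k. w p * f (Y p))"
  using assms by (simp add: linear_diff linear_sum linear_scale)

section \<open>The bracket identity in a single chart\<close>

context manifold begin

text \<open>The invariance of the sections of \<open>J\<close> enters through its consequences at x:
  \<open>fib\<close> allows the pairings in G to be evaluated in the chart \<kappa>, and
  \<open>iso\<close> gives the two relations behind the new u-entries.\<close>

lemma wade_bracket_hat_loc:
  fixes s1 s2 t1 t2 :: "'m \<Rightarrow> ('m, 'e) big"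
  assumes s: "big_section A h (points A) s1" "big_section A h (points A) s2"
    and c: "c \<in> rvec h"
    and V: "\<And>p. p < k \<Longrightarrow> vector_field A (points A) (V p)"
    and comm: "\<And>p q. p < k \<Longrightarrow> q < k \<Longrightarrow> lie_bracket A (V p) (V q) x = (\<lambda>\<kappa>. 0)"
    and w: "\<And>p. smooth_fun A (points A) (\<lambda>z. w1 z p)" "\<And>p. smooth_fun A (points A) (\<lambda>z. w2 z p)"
    and t: "\<And>z. z \<in> points A \<Longrightarrow> t1 z = hat A h k V z (w1 z) (s1 z)"
      "\<And>z. z \<in> points A \<Longrightarrow> t2 z = hat A h k V z (w2 z) (s2 z)"
    and t_sec: "big_section A (h + k) (points A) t1" "big_section A (h + k) (points A) t2"
    and fib: "\<And>q. q < k \<Longrightarrow> twisted_lie A h c (V q) s1 x \<in> big_fibre A h x"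
      "\<And>q. q < k \<Longrightarrow> twisted_lie A h c (V q) s2 x \<in> big_fibre A h x"
    and iso: "\<And>q. q < k \<Longrightarrow> metricG A h x (twisted_lie A h c (V q) s1 x) (s2 x) = 0"
      "\<And>q. q < k \<Longrightarrow> metricG A h x (s1 x) (twisted_lie A h c (V q) s2 x) = 0"
    and \<kappa>: "\<kappa> \<in> A" "x \<in> fst \<kappa>"
  defines "\<sigma> \<equiv> add_diff (wade_bracket A h c s1 s2 x)
      (lin_comb k (w2 x) (\<lambda>p. twisted_lie A h c (V p) s1 x))
      (lin_comb k (w1 x) (\<lambda>p. twisted_lie A h c (V p) s2 x))"
    and "\<omega> \<equiv> \<lambda>p. deriv_along A (\<lambda>z. vecX (t1 z)) (\<lambda>z. w2 z p) x - deriv_along A (\<lambda>z. vecX (t2 z)) (\<lambda>z. w1 z p) x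
      + dot h c (vecu (s1 x)) * w2 x p - dot h c (vecu (s2 x)) * w1 x p"
  shows "vecX (wade_bracket A (h + k) c t1 t2 x) \<kappa> = vecX \<sigma> \<kappa> - (\<Sum>p<k. \<omega> p *\<^sub>R V p x \<kappa>)" (is ?X)
    and "a < h \<Longrightarrow> vecu (wade_bracket A (h + k) c t1 t2 x) a = vecu \<sigma> a" (is "_ \<Longrightarrow> ?u")
    and "q < k \<Longrightarrow> vecu (wade_bracket A (h + k) c t1 t2 x) (h + q) = forma \<sigma> \<kappa> (V q x \<kappa>)" (is "_ \<Longrightarrow> ?u'")
    and "forma (wade_bracket A (h + k) c t1 t2 x) \<kappa> e = forma \<sigma> \<kappa> e" (is ?\<alpha>)
    and "a < h \<Longrightarrow> vecv (wade_bracket A (h + k) c t1 t2 x) a = vecv \<sigma> a" (is "_ \<Longrightarrow> ?v")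
    and "vecv (wade_bracket A (h + k) c t1 t2 x) (h + p) = \<omega> p" (is ?v')
proof -
  have x: "x \<in> points A" using fst_subset_points \<kappa> by blast
  have \<kappa>x: "\<kappa> \<in> charts_at A x" using \<kappa> by (simp add: charts_at_iff)
  define X1 X2 \<alpha>1 \<alpha>2 where "X1 = vecX (s1 x) \<kappa>" and "X2 = vecX (s2 x) \<kappa>"
    and "\<alpha>1 = forma (s1 x) \<kappa>" and "\<alpha>2 = forma (s2 x) \<kappa>"
  define LX1 LX2 where "LX1 = loc_deriv \<kappa> x (\<lambda>z. vecX (s1 z) \<kappa>)" and "LX2 = loc_deriv \<kappa> x (\<lambda>z. vecX (s2 z) \<kappa>)"
  define L1 L2 where "L1 v = loc_deriv \<kappa> x (\<lambda>z. forma (s1 z) \<kappa> v)" and "L2 v = loc_deriv \<kappa> x (\<lambda>z. forma (s2 z) \<kappa> v)" for v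
  define Lu1 Lu2 Lv1 Lv2 where "Lu1 a = loc_deriv \<kappa> x (\<lambda>z. vecu (s1 z) a)" 
    and "Lu2 a = loc_deriv \<kappa> x (\<lambda>z. vecu (s2 z) a)"
    and "Lv1 a = loc_deriv \<kappa> x (\<lambda>z. vecv (s1 z) a)" 
    and "Lv2 a = loc_deriv \<kappa> x (\<lambda>z. vecv (s2 z) a)" for a
  define Lw1 Lw2 where "Lw1 p = loc_deriv \<kappa> x (\<lambda>z. w1 z p)" and "Lw2 p = loc_deriv \<kappa> x (\<lambda>z. w2 z p)" for p
  define Y N where "Y p = V p x \<kappa>" and "N p = loc_deriv \<kappa> x (\<lambda>z. V p z \<kappa>)" for p
  define u1 u2 v1 v2 where "u1 = vecu (s1 x)" and "u2 = vecu (s2 x)" and "v1 = vecv (s1 x)" and "v2 = vecv (s2 x)"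
  define c1 c2 where "c1 = dot h c u1" and "c2 = dot h c u2"
  define Y1 Y2 where "Y1 = X1 - (\<Sum>p<k. w1 x p *\<^sub>R Y p)" and "Y2 = X2 - (\<Sum>p<k. w2 x p *\<^sub>R Y p)"
  note defs = X1_def X2_def \<alpha>1_def \<alpha>2_def LX1_def LX2_def L1_def L2_def Lu1_def Lu2_def Lv1_def Lv2_def
    Lw1_def Lw2_def Y_def N_def u1_def u2_def v1_def v2_def
  note sm1 = big_section_smooth[OF open_points s(1)] and sm2 = big_section_smooth[OF open_points s(2)]

  have sm_vec: "smooth_in \<kappa> (points A) (\<lambda>z. vecX (s1 z) \<kappa>)" "smooth_in \<kappa> (points A) (\<lambda>z. vecX (s2 z) \<kappa>)"
    using sm1(3) sm2(3) \<kappa>(1) by (simp_all add: vector_field_iff)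
  have sm_form: "smooth_in \<kappa> (points A) (\<lambda>z. forma (s1 z) \<kappa> v)" "smooth_in \<kappa> (points A) (\<lambda>z. forma (s2 z) \<kappa> v)" for v
    using sm1(4) sm2(4) \<kappa>(1) by (simp_all add: one_form_iff)
  have sm_uv: "smooth_in \<kappa> (points A) (\<lambda>z. vecu (s1 z) a)" "smooth_in \<kappa> (points A) (\<lambda>z. vecu (s2 z) a)"
      "smooth_in \<kappa> (points A) (\<lambda>z. vecv (s1 z) a)" "smooth_in \<kappa> (points A) (\<lambda>z. vecv (s2 z) a)" for a
    using sm1(1,2) sm2(1,2) \<kappa>(1) by (simp_all add: smooth_fun_iff)
  have sm_V: "smooth_in \<kappa> (points A) (\<lambda>z. V p z \<kappa>)" if "p < k" for p
    using V[OF that] \<kappa>(1) by (simp add: vector_field_iff)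
  note ll = linear_loc_deriv[OF _ \<kappa>(2) x]
  have lin: "linear LX1" "linear LX2" "linear \<alpha>1" "linear \<alpha>2" "\<And>v. linear (L1 v)" "\<And>v. linear (L2 v)"
    "\<And>a. linear (Lu1 a)" "\<And>a. linear (Lu2 a)" "\<And>a. linear (Lv1 a)" "\<And>a. linear (Lv2 a)"
    unfolding defs by (rule ll[OF sm_vec(1)] ll[OF sm_vec(2)] linear_one_form[OF sm1(4) \<kappa> x]
      linear_one_form[OF sm2(4) \<kappa> x] ll[OF sm_form(1)] ll[OF sm_form(2)]
      ll[OF sm_uv(1)] ll[OF sm_uv(2)] ll[OF sm_uv(3)] ll[OF sm_uv(4)])+
  have linN: "linear (N p)" if "p < k" for p unfolding defs by (rule ll[OF sm_V[OF that]])
  have lin': "linear (\<lambda>v. L1 v e)" "linear (\<lambda>v. L2 v e)" for e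
    unfolding defs
    using linear_loc_deriv_form[OF \<kappa>(1) open_points \<kappa>(2) x sm_form(1) linear_one_form[OF sm1(4) \<kappa>(1)]]
      linear_loc_deriv_form[OF \<kappa>(1) open_points \<kappa>(2) x sm_form(2) linear_one_form[OF sm2(4) \<kappa>(1)]]
    by simp_all
  have comm': "N q (Y p) = N p (Y q)" if "p < k" "q < k" for p q
    using comm[OF that, THEN fun_cong, of \<kappa>] unfolding lie_bracket_eq[OF \<kappa>x] defs by simp

  have t1x: "vecX (t1 x) \<kappa> = Y1" "forma (t1 x) = forma (s1 x)"
      "vecu (t1 x) = vec_append h u1 (\<lambda>p. if p < k then \<alpha>1 (Y p) else 0)" "vecv (t1 x) = vec_append h v1 (w1 x)"
    and t2x: "vecX (t2 x) \<kappa> = Y2" "forma (t2 x) = forma (s2 x)"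
      "vecu (t2 x) = vec_append h u2 (\<lambda>p. if p < k then \<alpha>2 (Y p) else 0)" "vecv (t2 x) = vec_append h v2 (w2 x)"
    using pairing_loc_form[OF sm1(4) V \<kappa> x] pairing_loc_form[OF sm2(4) V \<kappa> x]
    by (simp_all add: t[OF x] hat_def defs Y1_def Y2_def cong: if_cong)
  note loc1 = hat_loc[OF s(1) V w(1) t(1) \<kappa>, folded defs, simplified]
  note loc2 = hat_loc[OF s(2) V w(2) t(2) \<kappa>, folded defs, simplified]
  note W = wade_bracket_loc[OF s \<kappa>, where c = c, folded defs, folded c1_def c2_def]
  have chat: "dot (h + k) c (vecu (t1 x)) = c1" "dot (h + k) c (vecu (t2 x)) = c2"
    by (simp_all add: t1x t2x dot_rvec_append[OF c] c1_def c2_def)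
  note What = wade_bracket_loc[OF t_sec \<kappa>, where c = c, unfolded t1x t2x chat[unfolded t1x t2x], folded defs]
  note tl1 = twisted_lie_loc[OF s(1) V \<kappa>, where c = c, folded defs, folded c1_def]
  note tl2 = twisted_lie_loc[OF s(2) V \<kappa>, where c = c, folded defs, folded c2_def]
  have \<omega>: "\<omega> p = Lw2 p Y1 - Lw1 p Y2 + c1 * w2 x p - c2 * w1 x p" for p
  proof -
    have T: "vecX (t1 x) \<in> tangent_space A x" "vecX (t2 x) \<in> tangent_space A x"
      using t_sec x by (simp_all add: big_section_def big_fibre_iff)
    show ?thesis
      unfolding \<omega>_def c1_def c2_def u1_def u2_def Lw1_def Lw2_def
        deriv_along_eq[where X = "\<lambda>z. vecX (t1 z)", OF open_points w(2) x T(1) \<kappa>x]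
        deriv_along_eq[where X = "\<lambda>z. vecX (t2 z)", OF open_points w(1) x T(2) \<kappa>x] t1x t2x ..
  qed
  have \<sigma>X: "vecX \<sigma> \<kappa> = (LX2 X1 - LX1 X2) + (\<Sum>p<k. w2 x p *\<^sub>R ((LX1 (Y p) - N p X1) + c1 *\<^sub>R Y p))
      - (\<Sum>p<k. w1 x p *\<^sub>R ((LX2 (Y p) - N p X2) + c2 *\<^sub>R Y p))"
    unfolding \<sigma>_def add_diff_sel lin_comb_sel W by (simp add: tl1 tl2 cong: sum.cong_simp)
  have \<sigma>u: "vecu \<sigma> a = (Lu2 a X1 - Lu1 a X2) + (\<Sum>p<k. w2 x p * Lu1 a (Y p)) - (\<Sum>p<k. w1 x p * Lu2 a (Y p))" for a
    unfolding \<sigma>_def add_diff_sel lin_comb_sel W by (simp add: tl1 tl2 cong: sum.cong_simp)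
  have \<sigma>\<alpha>: "forma \<sigma> \<kappa> e = forma (wade_bracket A h c s1 s2 x) \<kappa> e
      + ((\<Sum>p<k. w2 x p * L1 e (Y p)) + (\<Sum>p<k. w2 x p * \<alpha>1 (N p e)))
      - ((\<Sum>p<k. w1 x p * L2 e (Y p)) + (\<Sum>p<k. w1 x p * \<alpha>2 (N p e)))" for e
    unfolding \<sigma>_def add_diff_sel lin_comb_sel
    by (simp add: tl1 tl2 distrib_left sum.distrib cong: sum.cong_simp)
  have \<sigma>v: "vecv \<sigma> a = vecv (wade_bracket A h c s1 s2 x) a
      + ((\<Sum>p<k. w2 x p * Lv1 a (Y p)) - (\<Sum>p<k. w2 x p * \<alpha>1 (Y p)) * c a)
      - ((\<Sum>p<k. w1 x p * Lv2 a (Y p)) - (\<Sum>p<k. w1 x p * \<alpha>2 (Y p)) * c a)" for a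
    unfolding \<sigma>_def add_diff_sel lin_comb_sel
    by (simp add: tl1 tl2 right_diff_distrib sum_subtractf sum_distrib_right mult.assoc cong: sum.cong_simp)
  have fY: "f Y1 = f X1 - (\<Sum>p<k. w1 x p * f (Y p))" "f Y2 = f X2 - (\<Sum>p<k. w2 x p * f (Y p))"
    if "linear f" for f :: "'e \<Rightarrow> real"
    unfolding Y1_def Y2_def by (simp_all add: linear_diff_sum[OF that])
  have \<alpha>L: "f (LX - (\<Sum>p<k. w' p *\<^sub>R N p e + l p *\<^sub>R Y p)) =
      f LX - ((\<Sum>p<k. w' p * f (N p e)) + (\<Sum>p<k. l p * f (Y p)))"
    if "linear f" for f :: "'e \<Rightarrow> real" and LX w' l e
    using that by (simp add: linear_diff linear_sum linear_add linear_scale sum.distrib)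

  have "(\<Sum>p<k. \<omega> p *\<^sub>R V p x \<kappa>) = (\<Sum>p<k. (Lw2 p Y1 - Lw1 p Y2 + c1 * w2 x p - c2 * w1 x p) *\<^sub>R Y p)"
    by (simp add: \<omega> Y_def)
  thus ?X
    using hat_bracket_vec[of LX1 LX2 k N Y Y1 X1 "w1 x" Y2 X2 "w2 x" "\<lambda>p. Lw2 p Y1" "\<lambda>p. Lw1 p Y2" c1 c2,
        OF lin(1,2) linN comm' Y1_def Y2_def]
    unfolding \<sigma>X What loc1(1) loc2(1) by simp

  show ?u if "a < h"
    unfolding \<sigma>u What loc1(2)[OF that] loc2(2)[OF that] fY(1)[OF lin(8)] fY(2)[OF lin(7)] by simp

  show ?v if "a < h"
  proof -
    \<comment> \<open>The new blocks contribute w1 \<cdot> \<alpha>2(V) - w2 \<cdot> \<alpha>1(V),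
      and the shift from X to Y in \<alpha>1(Y2) - \<alpha>2(Y1) contributes the same again. This
      absorbs the factor 1/2 and leaves exactly the multiples of c that come from
      \<open>vecv\<close> of \<open>twisted_lie\<close>.\<close>
    have d: "dot (h + k) (vec_append h u2 (\<lambda>p. if p < k then \<alpha>2 (Y p) else 0)) (vec_append h v1 (w1 x)) =
        dot h u2 v1 + (\<Sum>p<k. w1 x p * \<alpha>2 (Y p))"
      "dot (h + k) (vec_append h u1 (\<lambda>p. if p < k then \<alpha>1 (Y p) else 0)) (vec_append h v2 (w2 x)) =
        dot h u1 v2 + (\<Sum>p<k. w2 x p * \<alpha>1 (Y p))"
      unfolding dot_append by (simp_all add: dot_def mult.commute)
    show ?thesis
      unfolding \<sigma>v What W loc1(5)[OF that] loc2(5)[OF that] d fY(1)[OF lin(10)] fY(2)[OF lin(9)]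
        fY(1)[OF lin(4)] fY(2)[OF lin(3)]
      using that by (simp add: vec_append_def algebra_simps)
  qed

  show ?v'
  proof -
    \<comment> \<open>In the last block the multiple of c therefore drops out, and what remains of
      the y-component is \<omega>.\<close>
    have "c (h + p) = 0" using c by (simp add: rvec_def)
    thus ?thesis unfolding What loc1(6) loc2(6) \<omega> by (simp add: vec_append_def)
  qed

  show ?\<alpha>
  proof -
    \<comment> \<open>Combined with half the differential of w1 \<cdot> \<alpha>2(V) - w2 \<cdot>
      \<alpha>1(V), the new blocks lose their derivatives of \<alpha>(V), and the rest adds up to
      \<alpha>2(V) \<cdot> dw1 - \<alpha>1(V) \<cdot> dw2. This cancels the derivatives of w in the
      Lie derivatives along Y1 and Y2 and leaves the Lie derivatives along V that occur in
      \<sigma>.\<close>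
    have S: "(\<Sum>a<h + k. vec_append h u2 (\<lambda>p. if p < k then \<alpha>2 (Y p) else 0) a * loc_deriv \<kappa> x (\<lambda>z. vecv (t1 z) a) e) =
        (\<Sum>a<h. u2 a * Lv1 a e) + (\<Sum>p<k. Lw1 p e * \<alpha>2 (Y p))"
      "(\<Sum>a<h + k. vec_append h u1 (\<lambda>p. if p < k then \<alpha>1 (Y p) else 0) a * loc_deriv \<kappa> x (\<lambda>z. vecv (t2 z) a) e) =
        (\<Sum>a<h. u1 a * Lv2 a e) + (\<Sum>p<k. Lw2 p e * \<alpha>1 (Y p))"
      "(\<Sum>a<h + k. vec_append h v2 (w2 x) a * loc_deriv \<kappa> x (\<lambda>z. vecu (t1 z) a) e) =
        (\<Sum>a<h. v2 a * Lu1 a e) + ((\<Sum>p<k. w2 x p * L1 (Y p) e) + (\<Sum>p<k. w2 x p * \<alpha>1 (N p e)))"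
      "(\<Sum>a<h + k. vec_append h v1 (w1 x) a * loc_deriv \<kappa> x (\<lambda>z. vecu (t2 z) a) e) =
        (\<Sum>a<h. v1 a * Lu2 a e) + ((\<Sum>p<k. w1 x p * L2 (Y p) e) + (\<Sum>p<k. w1 x p * \<alpha>2 (N p e)))"
      unfolding sum_split_add
      by (simp_all add: vec_append_def loc1 loc2 mult.commute distrib_left sum.distrib cong: sum.cong_simp)
    show ?thesis
      unfolding \<sigma>\<alpha> What W S loc1(1,4) loc2(1,4) fY(1)[OF lin(6)] fY(2)[OF lin(5)]
        fY(1)[OF lin'(2)] fY(2)[OF lin'(1)] \<alpha>L[OF lin(3)] \<alpha>L[OF lin(4)]
      by (simp add: algebra_simps)
  qed

  show ?u' if q: "q < k"
  proof -
    have fs: "s1 x \<in> big_fibre A h x" "s2 x \<in> big_fibre A h x"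
      using s x by (simp_all add: big_section_def)
    note pe = pairing_eq[OF _ _ \<kappa>x]
    \<comment> \<open>Once the terms in \<open>w\<close> cancel, half the difference of the two isotropy relations remains.\<close>
    have i1: "\<alpha>2 (LX1 (Y q) - N q X1 + c1 *\<^sub>R Y q) + (L1 X2 (Y q) + \<alpha>1 (N q X2))
        + (\<Sum>a<h. Lu1 a (Y q) * v2 a) + (\<Sum>a<h. u2 a * (Lv1 a (Y q) - \<alpha>1 (Y q) * c a)) = 0"
      using iso(1)[OF q] fib(1)[OF q] fs
      by (simp add: metricG_def big_fibre_iff pe dot_def tl1[OF q])
         (simp add: defs)
    have i2: "\<alpha>1 (LX2 (Y q) - N q X2 + c2 *\<^sub>R Y q) + (L2 X1 (Y q) + \<alpha>2 (N q X1))
        + (\<Sum>a<h. Lu2 a (Y q) * v1 a) + (\<Sum>a<h. u1 a * (Lv2 a (Y q) - \<alpha>2 (Y q) * c a)) = 0"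
      using iso(2)[OF q] fib(2)[OF q] fs
      by (simp add: metricG_def big_fibre_iff pe dot_def tl2[OF q])
         (simp add: defs)
    have cs: "(\<Sum>a<h. u2 a * (Lv1 a (Y q) - \<alpha>1 (Y q) * c a)) = (\<Sum>a<h. u2 a * Lv1 a (Y q)) - \<alpha>1 (Y q) * c2"
      "(\<Sum>a<h. u1 a * (Lv2 a (Y q) - \<alpha>2 (Y q) * c a)) = (\<Sum>a<h. u1 a * Lv2 a (Y q)) - \<alpha>2 (Y q) * c1"
      by (simp_all add: c1_def c2_def dot_def sum_distrib_left right_diff_distrib sum_subtractf mult.left_commute mult.commute)
    have la: "f (a - b + r *\<^sub>R d) = f a - f b + r * f d" if "linear f" for f :: "'e \<Rightarrow> real" and a b d r
      using that by (simp add: linear_add linear_diff linear_scale)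
    \<comment> \<open>By commutativity the Lie derivative of \<alpha> along V p, evaluated on V q,
      is the derivative of \<alpha>(V q) along V p. This matches the terms in w on the two
      sides.\<close>
    have N: "(\<Sum>p<k. w p * f (N p (Y q))) = (\<Sum>p<k. w p * f (N q (Y p)))" for w :: "nat \<Rightarrow> real" and f :: "'e \<Rightarrow> real"
      by (rule sum.cong) (simp_all add: comm'[OF _ q])
    have vs: "(\<Sum>a<h. Lu1 a (Y q) * v2 a) = (\<Sum>a<h. v2 a * Lu1 a (Y q))" "(\<Sum>a<h. Lu2 a (Y q) * v1 a) = (\<Sum>a<h. v1 a * Lu2 a (Y q))"
      by (simp_all add: mult.commute)
    have \<alpha>N: "f (N q Y1) = f (N q X1) - (\<Sum>p<k. w1 x p * f (N q (Y p)))"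
        "f (N q Y2) = f (N q X2) - (\<Sum>p<k. w2 x p * f (N q (Y p)))" if "linear f" for f :: "'e \<Rightarrow> real"
      using fY[OF linear_compose[OF linN[OF q] that]] by (simp_all add: o_def)
    show ?thesis
      using i1 i2
      unfolding cs vs la[OF lin(3)] la[OF lin(4)]
      unfolding Y_def[symmetric] \<sigma>\<alpha> What W N loc1(3)[OF q] loc2(3)[OF q] fY(1)[OF lin(6)] fY(2)[OF lin(5)]
        \<alpha>N(1)[OF lin(4)] \<alpha>N(2)[OF lin(3)]
      by (simp add: algebra_simps)
  qed
qed

end

lemma hat_bundle_Big:
  "hat_bundle A h k V J = (\<lambda>x. {Big
      (\<lambda>\<kappa>. X \<kappa> - (\<Sum>p<k. w p *\<^sub>R V p x \<kappa>))
      (vec_append h u (\<lambda>p. if p < k then pairing A x \<alpha> (V p x) else 0))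
      \<alpha>
      (vec_append h v w)
    | X u \<alpha> v w. Big X u \<alpha> v \<in> J x \<and> w \<in> rvec k})"
proof
  fix x
  have "hat_bundle A h k V J x = {hat A h k V x w (Big X u \<alpha> v) | X u \<alpha> v w. Big X u \<alpha> v \<in> J x \<and> w \<in> rvec k}"
    unfolding hat_bundle_def by (rule set_eqI) (auto, metis big.exhaust)
  thus "hat_bundle A h k V J x = {Big
      (\<lambda>\<kappa>. X \<kappa> - (\<Sum>p<k. w p *\<^sub>R V p x \<kappa>))
      (vec_append h u (\<lambda>p. if p < k then pairing A x \<alpha> (V p x) else 0))
      \<alpha>
      (vec_append h v w)
    | X u \<alpha> v w. Big X u \<alpha> v \<in> J x \<and> w \<in> rvec k}"
    unfolding hat_def big.sel .
qed

section \<open>From the identity in a chart to closure of the sections\<close>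

context manifold begin

text \<open>Equality of whole families of components: besides the charts around x it concerns the
  charts that miss x and the u-entries from \<open>h + k\<close> on, where both sides vanish.
  \<open>\<sigma>_fib\<close> makes the value of \<open>forma \<sigma>\<close> on
  \<open>V q x\<close> independent of the chart and supplies the zeros of \<sigma> at the other
  charts.\<close>

lemma wade_bracket_hat:
  fixes s1 s2 t1 t2 :: "'m \<Rightarrow> ('m, 'e) big"
  assumes s: "big_section A h (points A) s1" "big_section A h (points A) s2"
    and c: "c \<in> rvec h"
    and V: "\<And>p. p < k \<Longrightarrow> vector_field A (points A) (V p)"
    and comm: "\<And>p q. p < k \<Longrightarrow> q < k \<Longrightarrow> lie_bracket A (V p) (V q) x = (\<lambda>\<kappa>. 0)"
    and w: "\<And>p. smooth_fun A (points A) (\<lambda>z. w1 z p)" "\<And>p. smooth_fun A (points A) (\<lambda>z. w2 z p)"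
    and t: "\<And>z. z \<in> points A \<Longrightarrow> t1 z = hat A h k V z (w1 z) (s1 z)"
      "\<And>z. z \<in> points A \<Longrightarrow> t2 z = hat A h k V z (w2 z) (s2 z)"
    and t_sec: "big_section A (h + k) (points A) t1" "big_section A (h + k) (points A) t2"
    and fib: "\<And>q. q < k \<Longrightarrow> twisted_lie A h c (V q) s1 x \<in> big_fibre A h x"
      "\<And>q. q < k \<Longrightarrow> twisted_lie A h c (V q) s2 x \<in> big_fibre A h x"
    and iso: "\<And>q. q < k \<Longrightarrow> metricG A h x (twisted_lie A h c (V q) s1 x) (s2 x) = 0"
      "\<And>q. q < k \<Longrightarrow> metricG A h x (s1 x) (twisted_lie A h c (V q) s2 x) = 0"
    and x: "x \<in> points A"
    and \<sigma>: "\<sigma> = add_diff (wade_bracket A h c s1 s2 x)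
      (lin_comb k (w2 x) (\<lambda>p. twisted_lie A h c (V p) s1 x))
      (lin_comb k (w1 x) (\<lambda>p. twisted_lie A h c (V p) s2 x))"
    and \<omega>: "\<omega> = (\<lambda>p. deriv_along A (\<lambda>z. vecX (t1 z)) (\<lambda>z. w2 z p) x - deriv_along A (\<lambda>z. vecX (t2 z)) (\<lambda>z. w1 z p) x
      + dot h c (vecu (s1 x)) * w2 x p - dot h c (vecu (s2 x)) * w1 x p)"
    and \<sigma>_fib: "\<sigma> \<in> big_fibre A h x"
  shows "wade_bracket A (h + k) c t1 t2 x = hat A h k V x \<omega> \<sigma>"
proof -
  obtain \<kappa>0 where \<kappa>0: "\<kappa>0 \<in> A" "x \<in> fst \<kappa>0" using x by (auto simp: points_def)
  have \<kappa>0x: "\<kappa>0 \<in> charts_at A x" using \<kappa>0 by (simp add: charts_at_iff)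
  note loc = wade_bracket_hat_loc[OF s c V comm w t t_sec fib iso, folded \<sigma> \<omega>]
  note loc0 = wade_bracket_hat_loc[OF s c V comm w t t_sec fib iso \<kappa>0, folded \<sigma> \<omega>]
  have Vx: "V p x \<in> tangent_space A x" if "p < k" for p
    using V[OF that] x by (simp add: vector_field_iff)
  have \<sigma>_sp: "vecX \<sigma> \<in> tangent_space A x" "forma \<sigma> \<in> cotangent_space A x"
    using \<sigma>_fib by (simp_all add: big_fibre_iff)
  have t_sp: "forma (t1 x) \<in> cotangent_space A x" "forma (t2 x) \<in> cotangent_space A x"
    using t_sec x by (simp_all add: big_section_def big_fibre_iff)
  have "vecX (wade_bracket A (h + k) c t1 t2 x) = vecX (hat A h k V x \<omega> \<sigma>)"
  proof
    fix \<kappa>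
    show "vecX (wade_bracket A (h + k) c t1 t2 x) \<kappa> = vecX (hat A h k V x \<omega> \<sigma>) \<kappa>"
    proof (cases "\<kappa> \<in> charts_at A x")
      case True
      thus ?thesis using loc(1) by (simp add: charts_at_iff hat_def \<omega>)
    next
      case False
      thus ?thesis
        using off_charts_space(1)[OF False \<sigma>_sp(1)] off_charts_space(1)[OF False Vx]
        by (simp add: wade_bracket_def Let_def off_charts hat_def cong: sum.cong_simp)
    qed
  qed
  moreover have "forma (wade_bracket A (h + k) c t1 t2 x) = forma (hat A h k V x \<omega> \<sigma>)"
  proof (intro ext)
    fix \<kappa> e
    show "forma (wade_bracket A (h + k) c t1 t2 x) \<kappa> e = forma (hat A h k V x \<omega> \<sigma>) \<kappa> e"
    proof (cases "\<kappa> \<in> charts_at A x")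
      case True
      thus ?thesis using loc(4) by (simp add: charts_at_iff hat_def)
    next
      case False
      thus ?thesis
        using off_charts_space(2)[OF False \<sigma>_sp(2)] off_charts_space(2)[OF False t_sp(1)]
          off_charts_space(2)[OF False t_sp(2)]
        by (simp add: wade_bracket_def Let_def off_charts hat_def)
    qed
  qed
  moreover have "vecv (wade_bracket A (h + k) c t1 t2 x) = vecv (hat A h k V x \<omega> \<sigma>)"
  proof
    fix a
    show "vecv (wade_bracket A (h + k) c t1 t2 x) a = vecv (hat A h k V x \<omega> \<sigma>) a"
      using loc0(5)[where a = a] loc0(6)[where p = "a - h"]
      by (cases "a < h") (simp_all add: hat_def vec_append_def \<omega>)
  qed
  moreover have "vecu (wade_bracket A (h + k) c t1 t2 x) = vecu (hat A h k V x \<omega> \<sigma>)"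
  proof
    fix a
    consider "a < h" | q where "q < k" "a = h + q" | "a \<ge> h + k"
      by (metis add_less_cancel_left le_iff_add not_le)
    thus "vecu (wade_bracket A (h + k) c t1 t2 x) a = vecu (hat A h k V x \<omega> \<sigma>) a"
    proof cases
      case 1
      thus ?thesis using loc0(2)[where a = a] by (simp add: hat_def vec_append_def)
    next
      case 2
      thus ?thesis using loc0(3)[where q = q] pairing_eq[OF \<sigma>_sp(2) Vx[OF 2(1)] \<kappa>0x]
        by (simp add: hat_def vec_append_def)
    next
      case 3
      have z: "vecu (t1 z) a = 0" "vecu (t2 z) a = 0" if "z \<in> points A" for z
        using t_sec that 3 by (simp_all add: big_section_def big_fibre_iff rvec_def)
      have "loc_deriv \<kappa>0 x (\<lambda>z. vecu (t1 z) a) e = 0" for e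
        by (rule loc_deriv_zero[OF \<kappa>0(1) open_points \<kappa>0(2) x]) (rule z(1))
      moreover have "loc_deriv \<kappa>0 x (\<lambda>z. vecu (t2 z) a) e = 0" for e
        by (rule loc_deriv_zero[OF \<kappa>0(1) open_points \<kappa>0(2) x]) (rule z(2))
      ultimately show ?thesis using 3 unfolding wade_bracket_loc(2)[OF t_sec \<kappa>0]
        by (simp add: hat_def vec_append_def)
    qed
  qed
  ultimately show ?thesis by (intro big.expand) simp
qed

text \<open>A choice of s and w point by point would not be smooth by itself. \<open>unhat\<close>
  and the last v-block are algebraic in the components of t and hence smooth, and since they invert
  \<open>hat\<close> they coincide with every pointwise choice.\<close>

lemma sections_hat_decompose:
  assumes fib: "\<And>x. x \<in> points A \<Longrightarrow> J x \<subseteq> big_fibre A h x"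
    and V: "\<And>p. p < k \<Longrightarrow> vector_field A (points A) (V p)"
    and t: "t \<in> sections A (h + k) (hat_bundle A h k V J)"
  obtains s w where "s \<in> sections A h J" "\<And>p. smooth_fun A (points A) (\<lambda>z. w z p)"
    "\<And>z. z \<in> points A \<Longrightarrow> w z \<in> rvec k" "\<And>z. z \<in> points A \<Longrightarrow> t z = hat A h k V z (w z) (s z)"
proof -
  define s where "s z = unhat h k V z (t z)" for z
  define w where "w z p = vecv (t z) (h + p)" for z p
  have t_sec: "big_section A (h + k) (points A) t" using t by (simp add: sections_def)
  have dec: "s z \<in> J z" "w z \<in> rvec k" "t z = hat A h k V z (w z) (s z)" if z: "z \<in> points A" for z
  proof -
    obtain s' w' where *: "t z = hat A h k V z w' s'" "s' \<in> J z" "w' \<in> rvec k"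
      using t z unfolding sections_def hat_bundle_def by blast
    have "s z = s'" unfolding s_def *(1) by (rule unhat_hat) (use fib[OF z] *(2) in blast)
    moreover have "w z = w'" by (rule ext) (simp add: w_def *(1) vecv_hat)
    ultimately show "s z \<in> J z" "w z \<in> rvec k" "t z = hat A h k V z (w z) (s z)" using * by simp_all
  qed
  have "big_section A h (points A) s"
    unfolding s_def by (rule big_section_unhat[OF open_points t_sec V])
  hence "s \<in> sections A h J" using dec(1) by (simp add: sections_def)
  moreover have "smooth_fun A (points A) (\<lambda>z. w z p)" for p
    unfolding w_def by (rule big_section_smooth(2)[OF open_points t_sec])
  ultimately show thesis using dec(2,3) by (rule that)
qed

lemma sections_lin_comb:
  assumes J: "\<And>x r a s. x \<in> points A \<Longrightarrow> (\<And>j. j < r \<Longrightarrow> s j \<in> J x) \<Longrightarrow> lin_comb r a s \<in> J x"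
    and s: "\<And>j. j < r \<Longrightarrow> s j \<in> sections A h J" and f: "\<And>j. j < r \<Longrightarrow> smooth_fun A (points A) (f j)"
  shows "(\<lambda>x. lin_comb r (\<lambda>j. f j x) (\<lambda>j. s j x)) \<in> sections A h J"
  using big_section_lin_comb[OF open_points, of r h s f] J s f unfolding sections_def by simp

text \<open>That the bracket is a smooth section of the big bundle is read off from
  \<open>hat \<omega> \<sigma>\<close>: \<sigma> is a combination, with smooth coefficients, of
  sections of \<open>J\<close> provided by \<open>closed\<close> and \<open>inv\<close>, and
  \<omega> is smooth by inspection.\<close>

lemma sections_hat_closed:
  assumes fib: "\<And>x. x \<in> points A \<Longrightarrow> J x \<subseteq> big_fibre A h x"
    and lin: "\<And>x r a s. x \<in> points A \<Longrightarrow> (\<And>j. j < r \<Longrightarrow> s j \<in> J x) \<Longrightarrow> lin_comb r a s \<in> J x"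
    and iso: "\<And>x s t. x \<in> points A \<Longrightarrow> s \<in> J x \<Longrightarrow> t \<in> J x \<Longrightarrow> metricG A h x s t = 0"
    and c: "c \<in> rvec h"
    and closed: "\<And>s1 s2. s1 \<in> sections A h J \<Longrightarrow> s2 \<in> sections A h J \<Longrightarrow> wade_bracket A h c s1 s2 \<in> sections A h J"
    and V: "\<And>p. p < k \<Longrightarrow> vector_field A (points A) (V p)"
    and comm: "\<And>p q x. p < k \<Longrightarrow> q < k \<Longrightarrow> x \<in> points A \<Longrightarrow> lie_bracket A (V p) (V q) x = (\<lambda>\<kappa>. 0)"
    and inv: "\<And>p s. p < k \<Longrightarrow> s \<in> sections A h J \<Longrightarrow> twisted_lie A h c (V p) s \<in> sections A h J"
    and t: "t1 \<in> sections A (h + k) (hat_bundle A h k V J)" "t2 \<in> sections A (h + k) (hat_bundle A h k V J)"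
  shows "wade_bracket A (h + k) c t1 t2 \<in> sections A (h + k) (hat_bundle A h k V J)"
proof -
  obtain s1 w1 where 1: "s1 \<in> sections A h J" "\<And>p. smooth_fun A (points A) (\<lambda>z. w1 z p)"
    "\<And>z. z \<in> points A \<Longrightarrow> w1 z \<in> rvec k" "\<And>z. z \<in> points A \<Longrightarrow> t1 z = hat A h k V z (w1 z) (s1 z)"
    using sections_hat_decompose[OF fib V t(1)] by blast
  obtain s2 w2 where 2: "s2 \<in> sections A h J" "\<And>p. smooth_fun A (points A) (\<lambda>z. w2 z p)"
    "\<And>z. z \<in> points A \<Longrightarrow> w2 z \<in> rvec k" "\<And>z. z \<in> points A \<Longrightarrow> t2 z = hat A h k V z (w2 z) (s2 z)"
    using sections_hat_decompose[OF fib V t(2)] by blast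
  have s: "big_section A h (points A) s1" "big_section A h (points A) s2"
    and t_sec: "big_section A (h + k) (points A) t1" "big_section A (h + k) (points A) t2"
    using 1(1) 2(1) t by (simp_all add: sections_def)
  define \<sigma> where "\<sigma> x = add_diff (wade_bracket A h c s1 s2 x)
      (lin_comb k (w2 x) (\<lambda>p. twisted_lie A h c (V p) s1 x))
      (lin_comb k (w1 x) (\<lambda>p. twisted_lie A h c (V p) s2 x))" for x
  define \<omega> where "\<omega> x p = deriv_along A (\<lambda>z. vecX (t1 z)) (\<lambda>z. w2 z p) x - deriv_along A (\<lambda>z. vecX (t2 z)) (\<lambda>z. w1 z p) x
      + dot h c (vecu (s1 x)) * w2 x p - dot h c (vecu (s2 x)) * w1 x p" for x p
  have comb: "(\<lambda>x. lin_comb k (w x) (\<lambda>p. twisted_lie A h c (V p) s x)) \<in> sections A h J"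
    if "s \<in> sections A h J" "\<And>p. smooth_fun A (points A) (\<lambda>z. w z p)" for s w
    using sections_lin_comb[OF lin inv[OF _ that(1)] that(2), of k] by simp
  \<comment> \<open>The \<open>add_diff\<close> in \<sigma> with its arguments as functions of the
    point, the form in which \<open>sections_lin_comb\<close> with the constant coefficients 1, 1,
    -1 applies.\<close>
  have "(\<lambda>x. lin_comb 3 (\<lambda>j. if j = 2 then -1 else 1) (\<lambda>j. (if j = 0 then wade_bracket A h c s1 s2
      else if j = 1 then (\<lambda>x. lin_comb k (w2 x) (\<lambda>p. twisted_lie A h c (V p) s1 x))
      else (\<lambda>x. lin_comb k (w1 x) (\<lambda>p. twisted_lie A h c (V p) s2 x))) x)) \<in> sections A h J" (is "?comb \<in> _")
    by (rule sections_lin_comb[OF lin])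
       (simp_all add: closed[OF 1(1) 2(1)] comb[OF 1(1) 2(2)] comb[OF 2(1) 1(2)] smooth_fun_const)
  moreover have "?comb = \<sigma>"
    unfolding \<sigma>_def add_diff_def by (intro ext arg_cong[where f = "lin_comb 3 _"]) simp
  ultimately have \<sigma>_sec: "\<sigma> \<in> sections A h J" by simp
  have eq: "hat A h k V x (\<omega> x) (\<sigma> x) = wade_bracket A (h + k) c t1 t2 x" if x: "x \<in> points A" for x
  proof (rule wade_bracket_hat[OF s c V comm[OF _ _ x] 1(2) 2(2) 1(4) 2(4) t_sec _ _ _ _ x \<sigma>_def _ , symmetric])
    have tl: "twisted_lie A h c (V q) s1 x \<in> J x" "twisted_lie A h c (V q) s2 x \<in> J x" if "q < k" for q
      using inv[OF that 1(1)] inv[OF that 2(1)] x by (simp_all add: sections_def)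
    have sx: "s1 x \<in> J x" "s2 x \<in> J x" using 1(1) 2(1) x by (simp_all add: sections_def)
    show "twisted_lie A h c (V q) s1 x \<in> big_fibre A h x" "twisted_lie A h c (V q) s2 x \<in> big_fibre A h x" if "q < k" for q
      using tl[OF that] fib[OF x] by blast+
    show "metricG A h x (twisted_lie A h c (V q) s1 x) (s2 x) = 0" 
      "metricG A h x (s1 x) (twisted_lie A h c (V q) s2 x) = 0" if "q < k" for q
      using iso[OF x] tl[OF that] sx by simp_all
    show "\<sigma> x \<in> big_fibre A h x" using \<sigma>_sec x by (simp add: sections_def big_section_def)
  qed (simp_all add: \<omega>_def fun_eq_iff)
  have \<omega>_smooth: "smooth_fun A (points A) (\<lambda>x. \<omega> x p)" for p
    unfolding \<omega>_def dot_def
    by (intro smooth_fun_add smooth_fun_diff smooth_fun_mult smooth_fun_sum open_points smooth_fun_const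
        1(2) 2(2) big_section_smooth(1)[OF open_points s(1)] big_section_smooth(1)[OF open_points s(2)]
        smooth_fun_deriv_along big_section_smooth(3)[OF open_points t_sec(1)] big_section_smooth(3)[OF open_points t_sec(2)])
  have \<omega>_rvec: "\<omega> x \<in> rvec k" if x: "x \<in> points A" for x
    unfolding rvec_def
  proof (intro CollectI allI impI)
    fix p assume p: "p \<ge> k"
    \<comment> \<open>Beyond \<open>k\<close> the entries of w1 and w2 vanish at all points, not
      only at x, so their derivatives vanish as well.\<close>
    have z: "w1 z p = 0" "w2 z p = 0" if "z \<in> points A" for z
      using 1(3)[OF that] 2(3)[OF that] p by (simp_all add: rvec_def)
    obtain \<kappa> where \<kappa>: "\<kappa> \<in> A" "x \<in> fst \<kappa>" using x by (auto simp: points_def)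
    hence \<kappa>x: "\<kappa> \<in> charts_at A x" by (simp add: charts_at_iff)
    have T: "vecX (t1 x) \<in> tangent_space A x" "vecX (t2 x) \<in> tangent_space A x"
      using t_sec x by (simp_all add: big_section_def big_fibre_iff)
    have "deriv_along A (\<lambda>z. vecX (t1 z)) (\<lambda>z. w2 z p) x = 0"
      by (subst deriv_along_eq[where X = "\<lambda>z. vecX (t1 z)", OF open_points 2(2) x T(1) \<kappa>x])
         (rule loc_deriv_zero[OF \<kappa>(1) open_points \<kappa>(2) x], rule z(2))
    moreover have "deriv_along A (\<lambda>z. vecX (t2 z)) (\<lambda>z. w1 z p) x = 0"
      by (subst deriv_along_eq[where X = "\<lambda>z. vecX (t2 z)", OF open_points 1(2) x T(2) \<kappa>x])
         (rule loc_deriv_zero[OF \<kappa>(1) open_points \<kappa>(2) x], rule z(1))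
    ultimately show "\<omega> x p = 0" by (simp add: \<omega>_def z[OF x])
  qed
  have "big_section A (h + k) (points A) (\<lambda>x. hat A h k V x (\<omega> x) (\<sigma> x))"
    using \<sigma>_sec \<omega>_smooth \<omega>_rvec V by (intro big_section_hat open_points) (simp_all add: sections_def)
  hence "big_section A (h + k) (points A) (wade_bracket A (h + k) c t1 t2)"
    by (rule big_section_cong[OF open_points]) (rule eq)
  moreover have "wade_bracket A (h + k) c t1 t2 x \<in> hat_bundle A h k V J x" if "x \<in> points A" for x
    unfolding eq[OF that, symmetric]
    by (rule hat_bundleI) (use \<sigma>_sec \<omega>_rvec that in \<open>simp_all add: sections_def\<close>)
  ultimately show ?thesis by (simp add: sections_def)
qed

end

theorem proposition2p3:
  fixes A :: "('m::{t2_space, second_countable_topology}, 'e::real_normed_vector) chart set"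
    and h k :: nat
    and c :: "nat \<Rightarrow> real"
    and \<tau> :: "(nat \<Rightarrow> real) \<Rightarrow> real"
    and J :: "'m \<Rightarrow> ('m, 'e) big set"
    and V :: "nat \<Rightarrow> 'm \<Rightarrow> ('m, 'e) tvec"
  assumes "smooth_manifold A"
    and "k \<ge> 1"
    and "c \<in> rvec h"
    and "\<And>t. t \<in> rvec h \<Longrightarrow> \<tau> t = (\<Sum>a<h. c a * t a)"
    and "stable_dirac_jacobi A h \<tau> J"
    and "\<And>p. p < k \<Longrightarrow> vector_field A (points A) (V p)"
    and "\<And>p q x. p < k \<Longrightarrow> q < k \<Longrightarrow> x \<in> points A \<Longrightarrow> lie_bracket A (V p) (V q) x = (\<lambda>\<kappa>. 0)"
    and "\<And>p s. p < k \<Longrightarrow> s \<in> sections A h J \<Longrightarrow>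
      (\<lambda>x. Big
         (\<lambda>\<kappa>. lie_bracket A (V p) (\<lambda>z. vecX (s z)) x \<kappa> + dot h c (vecu (s x)) *\<^sub>R V p x \<kappa>)
         (\<lambda>a. deriv_along A (V p) (\<lambda>z. vecu (s z) a) x)
         (lie_form A (V p) (\<lambda>z. forma (s z)) x)
         (\<lambda>a. deriv_along A (V p) (\<lambda>z. vecv (s z) a) x - pairing A x (forma (s x)) (V p x) * c a))
      \<in> sections A h J"
  shows "stable_dirac_jacobi A (h + k) (\<lambda>ts. \<tau> (vec_take h ts))
    (\<lambda>x. {Big
            (\<lambda>\<kappa>. X \<kappa> - (\<Sum>p<k. w p *\<^sub>R V p x \<kappa>))
            (vec_append h u (\<lambda>p. if p < k then pairing A x \<alpha> (V p x) else 0))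
            \<alpha>
            (vec_append h v w)
          | X u \<alpha> v w. Big X u \<alpha> v \<in> J x \<and> w \<in> rvec k})"
proof -
  interpret manifold A using assms(1) by unfold_locales
  note c = assms(3) and V = assms(6) and comm = assms(7)
  have inv: "twisted_lie A h c (V p) s \<in> sections A h J" if "p < k" "s \<in> sections A h J" for p s
    using assms(8)[OF that] unfolding twisted_lie_def .
  have sub: "subbundle A h (dim (UNIV :: 'e set) + h) J"
    and max: "\<And>x. x \<in> points A \<Longrightarrow> maximal_isotropic A h x (J x)"
    using assms(5) by (simp_all add: stable_dirac_jacobi_def)
  obtain c' where c': "c' \<in> rvec h" "\<And>t. t \<in> rvec h \<Longrightarrow> \<tau> t = dot h c' t"
    and closed': "\<And>s1 s2. s1 \<in> sections A h J \<Longrightarrow> s2 \<in> sections A h J \<Longrightarrow> wade_bracket A h c' s1 s2 \<in> sections A h J"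
    using assms(5) unfolding stable_dirac_jacobi_def by blast
  \<comment> \<open>The structure on \<open>J\<close> only provides some coefficient vector of
    \<tau>, whereas the invariance hypothesis is phrased with \<open>c\<close>. The values of \<tau>
    on unit vectors identify the two.\<close>
  have "c' = c"
  proof
    fix a :: nat
    define e where "e = (\<lambda>i. if i = a then 1 else 0 :: real)"
    show "c' a = c a"
    proof (cases "a < h")
      case True
      hence "e \<in> rvec h" by (auto simp: e_def rvec_def)
      with assms(4) c'(2) have "(\<Sum>i<h. c i * e i) = (\<Sum>i<h. c' i * e i)" by (simp add: dot_def)
      thus ?thesis using True by (simp add: e_def if_distrib[of "(*) _"] cong: if_cong)
    next
      case False thus ?thesis using c c'(1) by (simp add: rvec_def)
    qed
  qed
  note closed = closed'[unfolded \<open>c' = c\<close>]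
  have fib: "\<And>x. x \<in> points A \<Longrightarrow> J x \<subseteq> big_fibre A h x"
    and lin: "\<And>x r a s. x \<in> points A \<Longrightarrow> (\<And>j. j < r \<Longrightarrow> s j \<in> J x) \<Longrightarrow> lin_comb r a s \<in> J x"
    and iso: "\<And>x s t. x \<in> points A \<Longrightarrow> s \<in> J x \<Longrightarrow> t \<in> J x \<Longrightarrow> metricG A h x s t = 0"
    using max by (simp_all add: maximal_isotropic_def isotropic_subspace_def)
  have "subbundle A (h + k) (dim (UNIV :: 'e set) + (h + k)) (hat_bundle A h k V J)"
    using subbundle_hat[OF sub fib V] by (simp add: add.assoc)
  moreover have "maximal_isotropic A (h + k) x (hat_bundle A h k V J x)" if "x \<in> points A" for x
    by (rule maximal_isotropic_hat[where J = J, OF max[OF that] that]) (use V that in \<open>simp add: vector_field_iff\<close>)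
  \<comment> \<open>Padded by zeros, which the encoding of vectors does without any change, c is
    also the coefficient vector of (t, s) \<mapsto> \<tau>(t).\<close>
  moreover have "c \<in> rvec (h + k)" using c by (simp add: rvec_def)
  moreover have "\<tau> (vec_take h ts) = dot (h + k) c ts" for ts
  proof -
    have "vec_take h ts \<in> rvec h" by (simp add: vec_take_def rvec_def)
    hence "\<tau> (vec_take h ts) = (\<Sum>a<h. c a * vec_take h ts a)" by (rule assms(4))
    also have "\<dots> = (\<Sum>a<h. c a * ts a)" by (simp add: vec_take_def)
    also have "\<dots> = dot (h + k) c ts"
      unfolding dot_def sum_split_add using c by (simp add: rvec_def)
    finally show ?thesis .
  qed
  moreover have "wade_bracket A (h + k) c t1 t2 \<in> sections A (h + k) (hat_bundle A h k V J)"
    if "t1 \<in> sections A (h + k) (hat_bundle A h k V J)" "t2 \<in> sections A (h + k) (hat_bundle A h k V J)" for t1 t2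
    by (rule sections_hat_closed[OF fib lin iso c closed V comm inv that])
  ultimately have "stable_dirac_jacobi A (h + k) (\<lambda>ts. \<tau> (vec_take h ts)) (hat_bundle A h k V J)"
    unfolding stable_dirac_jacobi_def by (intro conjI ballI bexI[of _ c]) simp_all
  thus ?thesis by (simp only: hat_bundle_Big)
qed

end
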